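(* Let $P=\{x\in\mathbb{R}^n \mid \gamma_k\cdot x\le \eta_k,\ \forall k\in\mathcal{K}_X\}\subseteq R_X$, with $\eta\in\mathbb{R}^{|\mathcal{K}_X|}$. Let $d^*$ and $\left(t^*,(\lambda^{k*})_{k\in\mathcal{K}_X},(\tilde\lambda^{k*})_{k\in\mathcal{K}_X},\theta^*\right)$ be the optimal value and an optimal solution of the following linear program: $$ \begin{array}{lll} \text{maximize} & t\\ \text{over} & t\in\mathbb{R},\ \theta\in\mathbb{R}^q,\ \lambda^k\in\mathbb{R}^{|\mathcal{K}_X|},\ \tilde\lambda^k\in\mathbb{R}^{|\mathcal{K}_D|}, & k\in\mathcal{K}_X\\ \text{subject to} & \lambda^k_i\ge 0, & k\in\mathcal{K}_X,\ i\in\mathcal{K}_X\setminus\{k\},\\ & \tilde\lambda^k_j\ge 0, & k\in\mathcal{K}_X,\ j\in\mathcal{K}_D,\\ & \alpha_{U,l}\cdot H_b(\overline{v_X})\theta\le\beta_{U,l}, & l\in\mathcal{K}_U,\ \overline{v_X}\in\overline{V_X'},\\ & t\le -\gamma_k\cdot\left(f_b(\overline{v_X},\overline{v_D})+G_b(\overline{v_X},\overline{v_D})\theta\right)+\sum_{i\in\mathcal{K}_X}\lambda^k_i(\gamma_i'\cdot\overline{v_X}-\eta_i)\\ & \qquad +\sum_{j\in\mathcal{K}_D}\tilde\lambda^k_j(\alpha_{D,j}'\cdot\overline{v_D}-\beta_{D,j}), & k\in\mathcal{K}_X,\ \overline{v_X}\in\overline{V_X'},\ \overline{v_D}\in\overline{V_D'}.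 \end{array} $$ (The components $\lambda^k_k$ are not sign-constrained.) If $d^*$ is positive, then the controller $h(x)=H(x)\theta^*$ satisfies $h(x)\in U$ for all $x\in R_X$, and the controlled system $$\dot x(t)=f(x(t),d(t))+g(x(t),d(t))h(x(t)),\quad d(t)\in D,$$ is $P$-invariant.
   Context: **System.** $f:\mathbb{R}^n\times\mathbb{R}^m\to\mathbb{R}^n$, $g:\mathbb{R}^n\times\mathbb{R}^m\to\mathbb{R}^{n\times p}$ and $H:\mathbb{R}^n\to\mathbb{R}^{p\times q}$ are given multivariate polynomial maps, and $G(x,d)=g(x,d)H(x)$. The state set is $R_X=[\underline{x_1},\overline{x_1}]\times\dots\times[\underline{x_n},\overline{x_n}]$ with $\underline{x_k}<\overline{x_k}$ for all $k$. The disturbance set $D=\{d\in\mathbb{R}^m\mid\alpha_{D,k}\cdot d\le\beta_{D,k},\ \forall k\in\mathcal{K}_D\}$ and the input set $U=\{u\in\mathbb{R}^p\mid\alpha_{U,k}\cdot u\le\beta_{U,k},\ \forall k\in\mathcal{K}_U\}$ are (nonempty) convex compact polytopes, with $\mathcal{K}_D,\mathcal{K}_U$ finite. $R_D=[\underline{d_1},\overline{d_1}]\times\dots\times[\underline{d_m},\overline{d_m}]$ is the smallest rectangle containing $D$. $\mathcal{K}_X$ is a finite index set and $\gamma_k\in\mathbb{R}^n$, $k\in\mathcal{K}_X$, are given vectors. **Invariance.** The controlled system is $P$-invariant if all its trajectories with $x(0)\in P$ satisfy $x(t)\in P$ for all $t\ge 0$, for all possible disturbances. Here a trajectory is a maximal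 (absolutely continuous) solution of the differential equation for some measurable disturbance signal $d$ with values in $D$, where $h(x)=H(x)\theta^*$ is read as a polynomial expression on $\mathbb{R}^n$. **Degrees and blossoms.** $\delta_1,\dots,\delta_n,\rho_1,\dots,\rho_m\ge 1$ are integers such that the entries of $f$ and $G$ have degree at most $\delta_i$ in $x_i$ and at most $\rho_j$ in $d_j$, and the entries of $H$ have degree at most $\delta_i$ in $x_i$. For a polynomial $p(y)=\sum_{(e_1,\dots,e_r)}p_{(e_1,\dots,e_r)}y_1^{e_1}\cdots y_r^{e_r}$ regarded as having degrees $\epsilon_1,\dots,\epsilon_r$ in $y_1,\dots,y_r$ (i.e. $0\le e_i\le\epsilon_i$), its blossom is the multi-affine function of $z=(z_{1,1},\dots,z_{1,\epsilon_1},\dots,z_{r,1},\dots,z_{r,\epsilon_r})$ given by $$\sum_{(e_1,\dots,e_r)}p_{(e_1,\dots,e_r)}\prod_{i=1}^r B_{e_i,\epsilon_i}(z_{i,1},\dots,z_{i,\epsilon_i}),\qquad B_{e,\epsilon}(z_1,\dots,z_\epsilon)=\binom{\epsilon}{e}^{-1}\sum_{\sigma}\prod_{s\in\sigma}z_s,$$ where $\sigma$ ranges over the $e$-element subsets of $\{1,\dots,\epsilon\}$. Blossoms of vector- or matrix-valued maps are taken entrywise. $f_b,G_b$ are the blossoms of $f,G$ regarded as having degrees $\delta_1,\dots,\delta_n,\rho_1,\dots,\rho_m$ in $x_1,\dots,x_n,d_1,\dots,d_m$; $H_b$ is the blossom of $H$ regarded as having degrees $\delta_1,\dots,\delta_n$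 in $x_1,\dots,x_n$. **Vertices.** $V_X'=\{\underline{x_1},\overline{x_1}\}^{\delta_1}\times\dots\times\{\underline{x_n},\overline{x_n}\}^{\delta_n}$ and $V_D'=\{\underline{d_1},\overline{d_1}\}^{\rho_1}\times\dots\times\{\underline{d_m},\overline{d_m}\}^{\rho_m}$. Write $z\cong z'$ if, for each $i$, the block $(z_{i,1},z_{i,2},\dots)$ is a permutation of the block $(z'_{i,1},z'_{i,2},\dots)$. $\overline{V_X'}=V_X'/\cong$ and $\overline{V_D'}=V_D'/\cong$; all expressions evaluated on classes are independent of the representative. **Lifted vectors.** $\gamma_i'=(\frac{\gamma_{i,1}}{\delta_1},\dots,\frac{\gamma_{i,1}}{\delta_1},\dots,\frac{\gamma_{i,n}}{\delta_n},\dots,\frac{\gamma_{i,n}}{\delta_n})$ with $\frac{\gamma_{i,s}}{\delta_s}$ repeated $\delta_s$ times, and $\alpha_{D,j}'=(\frac{\alpha_{D,j,1}}{\rho_1},\dots,\frac{\alpha_{D,j,1}}{\rho_1},\dots,\frac{\alpha_{D,j,m}}{\rho_m},\dots,\frac{\alpha_{D,j,m}}{\rho_m})$ with $\frac{\alpha_{D,j,s}}{\rho_s}$ repeated $\rho_s$ times. *)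

theory Defs
  imports "HOL-Analysis.Analysis" "HOL-Library.Poly_Mapping" "HOL-Combinatorics.Permutations"
begin

section \<open>Multivariate polynomials\<close>

text \<open>
  A real polynomial in variables indexed by the finite type \<open>'r\<close> is a finitely supported map
  from exponent vectors to coefficients.  Polynomials in \<open>(x, d)\<close> use the index type \<open>'n + 'm\<close>.
\<close>

type_synonym 'r rpoly = "('r \<Rightarrow>\<^sub>0 nat) \<Rightarrow>\<^sub>0 real"

definition poly_eval :: "'r::finite rpoly \<Rightarrow> ('r \<Rightarrow> real) \<Rightarrow> real" where
  "poly_eval p y =
     (\<Sum>e\<in>Poly_Mapping.keys p. Poly_Mapping.lookup p e * (\<Prod>i\<in>UNIV. y i ^ Poly_Mapping.lookup e i))"

definition degrees_le :: "('r \<Rightarrow> nat) \<Rightarrow> 'r rpoly \<Rightarrow> bool" where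
  "degrees_le \<epsilon> p \<longleftrightarrow> (\<forall>e\<in>Poly_Mapping.keys p. \<forall>i. Poly_Mapping.lookup e i \<le> \<epsilon> i)"

definition eval_vec :: "('r::finite rpoly) ^ 'a \<Rightarrow> ('r \<Rightarrow> real) \<Rightarrow> real ^ 'a" where
  "eval_vec F y = (\<chi> i. poly_eval (F $ i) y)"

definition eval_mat :: "('r::finite rpoly) ^ 'b ^ 'a \<Rightarrow> ('r \<Rightarrow> real) \<Rightarrow> real ^ 'b ^ 'a" where
  "eval_mat A y = (\<chi> i j. poly_eval (A $ i $ j) y)"

definition join :: "real ^ 'n \<Rightarrow> real ^ 'm \<Rightarrow> 'n + 'm \<Rightarrow> real" where
  "join x d = case_sum (($) x) (($) d)"

section \<open>Blossoms\<close>

definition blossom_basis :: "nat \<Rightarrow> nat \<Rightarrow> (nat \<Rightarrow> real) \<Rightarrow> real" where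
  "blossom_basis e \<epsilon> w =
     inverse (real (\<epsilon> choose e)) * (\<Sum>\<sigma> | \<sigma> \<subseteq> {1..\<epsilon>} \<and> card \<sigma> = e. \<Prod>s\<in>\<sigma>. w s)"

text \<open>
  The lifted variable \<open>z\<^sub>i\<^sub>,\<^sub>s\<close> is \<open>z i s\<close>; only the positions \<open>s \<in> {1..\<epsilon> i}\<close> of block \<open>i\<close> matter.
\<close>

definition blossom :: "('r::finite \<Rightarrow> nat) \<Rightarrow> 'r rpoly \<Rightarrow> ('r \<Rightarrow> nat \<Rightarrow> real) \<Rightarrow> real" where
  "blossom \<epsilon> p z =
     (\<Sum>e\<in>Poly_Mapping.keys p. Poly_Mapping.lookup p e *
        (\<Prod>i\<in>UNIV. blossom_basis (Poly_Mapping.lookup e i) (\<epsilon> i) (z i)))"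

definition blossom_vec ::
  "('r::finite \<Rightarrow> nat) \<Rightarrow> ('r rpoly) ^ 'a \<Rightarrow> ('r \<Rightarrow> nat \<Rightarrow> real) \<Rightarrow> real ^ 'a" where
  "blossom_vec \<epsilon> F z = (\<chi> i. blossom \<epsilon> (F $ i) z)"

definition blossom_mat ::
  "('r::finite \<Rightarrow> nat) \<Rightarrow> ('r rpoly) ^ 'b ^ 'a \<Rightarrow> ('r \<Rightarrow> nat \<Rightarrow> real) \<Rightarrow> real ^ 'b ^ 'a" where
  "blossom_mat \<epsilon> A z = (\<chi> i j. blossom \<epsilon> (A $ i $ j) z)"

section \<open>Lifted vertices and lifted vectors\<close>

definition lifted_vertices ::
  "('r::finite \<Rightarrow> nat) \<Rightarrow> real ^ 'r \<Rightarrow> real ^ 'r \<Rightarrow> ('r \<Rightarrow> nat \<Rightarrow> real) set" where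
  "lifted_vertices \<epsilon> lo hi = (\<Pi>\<^sub>E i\<in>UNIV. \<Pi>\<^sub>E s\<in>{1..\<epsilon> i}. {lo $ i, hi $ i})"

definition block_perm ::
  "('r \<Rightarrow> nat) \<Rightarrow> ('r \<Rightarrow> nat \<Rightarrow> real) \<Rightarrow> ('r \<Rightarrow> nat \<Rightarrow> real) \<Rightarrow> bool" where
  "block_perm \<epsilon> z z' \<longleftrightarrow>
     (\<forall>i. \<exists>\<pi>. \<pi> permutes {1..\<epsilon> i} \<and> (\<forall>s\<in>{1..\<epsilon> i}. z' i s = z i (\<pi> s)))"

definition vertex_classes ::
  "('r::finite \<Rightarrow> nat) \<Rightarrow> real ^ 'r \<Rightarrow> real ^ 'r \<Rightarrow> ('r \<Rightarrow> nat \<Rightarrow> real) set set" where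
  "vertex_classes \<epsilon> lo hi =
     lifted_vertices \<epsilon> lo hi //
       {(z, z'). z \<in> lifted_vertices \<epsilon> lo hi \<and> z' \<in> lifted_vertices \<epsilon> lo hi \<and> block_perm \<epsilon> z z'}"

text \<open>
  Expressions on a class are evaluated at this representative; their values do not depend on the
  choice, as they are invariant under permutations within blocks.
\<close>

definition rep :: "'a set \<Rightarrow> 'a" where
  "rep c = (SOME z. z \<in> c)"

definition lift_vec :: "('r::finite \<Rightarrow> nat) \<Rightarrow> real ^ 'r \<Rightarrow> 'r \<Rightarrow> nat \<Rightarrow> real" where
  "lift_vec \<epsilon> v = (\<lambda>i s. v $ i / real (\<epsilon> i))"

definition lifted_inner ::
  "('r::finite \<Rightarrow> nat) \<Rightarrow> ('r \<Rightarrow> nat \<Rightarrow> real) \<Rightarrow> ('r \<Rightarrow> nat \<Rightarrow> real) \<Rightarrow> real" where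
  "lifted_inner \<epsilon> w z = (\<Sum>i\<in>UNIV. \<Sum>s=1..\<epsilon> i. w i s * z i s)"

section \<open>Trajectories and invariance\<close>

text \<open>
  Absolute continuity of a function on a real interval; the measure-theoretic notion of the same
  name in the library is a different one.  For an interval \<open>K = {a..b}\<close>, \<open>Inf K\<close> and \<open>Sup K\<close> are
  its end points.
\<close>

definition absolutely_continuous_on :: "real set \<Rightarrow> (real \<Rightarrow> 'a::real_normed_vector) \<Rightarrow> bool" where
  "absolutely_continuous_on I x \<longleftrightarrow>
     (\<forall>\<epsilon>>0. \<exists>\<delta>>0. \<forall>\<D> S. \<D> division_of S \<and> S \<subseteq> I \<and> (\<Sum>K\<in>\<D>. Sup K - Inf K) < \<delta> \<longrightarrow>
        (\<Sum>K\<in>\<D>. norm (x (Sup K) - x (Inf K))) < \<epsilon>)"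

text \<open>
  Solutions (in the sense of Caratheodory) of \<open>x' = F x d\<close> starting at time 0; the domain \<open>I\<close> is
  \<open>{0..T}\<close>, \<open>{0..<T}\<close> or \<open>{0..}\<close>.
\<close>

definition solution_on ::
  "('a::real_normed_vector \<Rightarrow> 'd \<Rightarrow> 'a) \<Rightarrow> (real \<Rightarrow> 'd) \<Rightarrow> real set \<Rightarrow> (real \<Rightarrow> 'a) \<Rightarrow> bool" where
  "solution_on F d I x \<longleftrightarrow>
     is_interval I \<and> 0 \<in> I \<and> I \<subseteq> {0..} \<and>
     (\<forall>a b. {a..b} \<subseteq> I \<longrightarrow> absolutely_continuous_on {a..b} x) \<and>
     (\<exists>N. negligible N \<and> (\<forall>t\<in>I - N. (x has_vector_derivative F (x t) (d t)) (at t within I)))"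

definition maximal_solution_on ::
  "('a::real_normed_vector \<Rightarrow> 'd \<Rightarrow> 'a) \<Rightarrow> (real \<Rightarrow> 'd) \<Rightarrow> real set \<Rightarrow> (real \<Rightarrow> 'a) \<Rightarrow> bool" where
  "maximal_solution_on F d I x \<longleftrightarrow>
     solution_on F d I x \<and>
     \<not> (\<exists>J y. solution_on F d J y \<and> I \<subset> J \<and> (\<forall>t\<in>I. y t = x t))"

definition disturbance_signal :: "'d::euclidean_space set \<Rightarrow> (real \<Rightarrow> 'd) \<Rightarrow> bool" where
  "disturbance_signal D d \<longleftrightarrow> d \<in> borel_measurable (lebesgue_on {0..}) \<and> (\<forall>t\<ge>0. d t \<in> D)"

text \<open>
  Since \<open>x t \<in> P\<close> is required at all times \<open>t \<ge> 0\<close>, every maximal solution starting in \<open>P\<close> has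
  to be defined on all of \<open>{0..}\<close>.
\<close>

definition invariant_under ::
  "('a::real_normed_vector \<Rightarrow> 'd::euclidean_space \<Rightarrow> 'a) \<Rightarrow> 'd set \<Rightarrow> 'a set \<Rightarrow> bool" where
  "invariant_under F D P \<longleftrightarrow>
     (\<forall>d I x. disturbance_signal D d \<and> maximal_solution_on F d I x \<and> x 0 \<in> P \<longrightarrow>
        I = {0..} \<and> (\<forall>t\<ge>0. x t \<in> P))"

end

theory Submission
  imports Defs
begin

text \<open>
  A blossom is affine in each of its variables, so an inequality between such functions that holds at
  all vertices of a box holds on the whole box, in particular on the diagonal, where the blossom of a
  polynomial is the polynomial itself.  Hence the constraints of the linear program give
  \<open>h(x) \<in> U\<close> on \<open>R\<^sub>X\<close> and, for \<open>x \<in> R\<^sub>X\<close> and \<open>d \<in> R\<^sub>D\<close>,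
  \<open>\<gamma>\<^sub>k \<bullet> F x d \<le> - t + (\<Sum>i. \<lambda>\<^sub>i (\<gamma>\<^sub>i \<bullet> x - \<eta>\<^sub>i)) + (\<Sum>j. \<mu>\<^sub>j (\<alpha>\<^sub>j \<bullet> d - \<beta>\<^sub>j))\<close>,
  where both sums are nonpositive if \<open>d \<in> D\<close> and \<open>x\<close> lies on the \<open>k\<close>-th facet of \<open>P\<close>.  As \<open>t > 0\<close>,
  the vector field points strictly inwards on each facet.  By compactness of \<open>D\<close> this persists near
  the facet, so no solution leaves \<open>P\<close>, and a maximal solution that stays in the compact set \<open>P\<close> is
  global by Caratheodory's existence theorem.
\<close>

section \<open>Absolutely continuous functions\<close>

text \<open>The differential equation is known to hold only almost everywhere, so the mean value
  theorem does not apply. One substitute, the estimate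
  \<open>absolutely_continuous_on_increment_le\<close>, serves twice: with slope 0 it shows that a
  facet functional cannot grow, and with a speed bound it makes a solution in a compact set
  Lipschitz. Working with increments avoids integrating derivatives of absolutely continuous
  functions. Invariance also asks that maximal solutions live for all times, so every solution with
  a bounded domain has to be continued. Disturbances are merely measurable; hence existence is
  needed in the sense of Caratheodory, and Lebesgue differentiation is needed to recover the
  equation from its integral form. The strict sign obtained from the positive margin is also what
  controls states slightly outside \<open>P\<close>, where the sums with the multipliers may be
  positive.\<close>

lemma negligible_outer_open:
  fixes N :: "'a::euclidean_space set"
  assumes "negligible N" "e > 0"
  obtains U where "open U" "N \<subseteq> U" "U \<in> lmeasurable" "measure lebesgue U < e"
proof -
  obtain U where U: "open U" "N \<subseteq> U" "U - N \<in> lmeasurable" "emeasure lebesgue (U - N) < ennreal e"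
    using sets_lebesgue_outer_open[OF negligible_imp_sets[OF assms(1)] assms(2)] by metis
  have null: "N \<in> null_sets lebesgue"
    using assms(1) negligible_iff_null_sets by blast
  have lm: "U \<in> lmeasurable"
    using U null by (metis borel_open measurable_Diff_null_set sets_completionI_sets sets_lborel)
  \<comment> \<open>Outer regularity bounds only \<open>U - N\<close>; removing the null set
    \<open>N\<close> does not change the measure of \<open>U\<close>.\<close>
  have "measure lebesgue (U - N) = measure lebesgue U"
    using null lm by (simp add: fmeasurableD measure_Diff_null_set)
  moreover have "measure lebesgue (U - N) < e"
    using U(3,4) assms(2) by (metis emeasure_eq_measure2 ennreal_leI not_less)
  ultimately show thesis
    using that U lm by metis
qed

lemma absolutely_continuous_onE:
  assumes "absolutely_continuous_on I x" "e > 0"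
  obtains \<delta> where "\<delta> > 0"
    "\<And>\<D> S. \<D> division_of S \<Longrightarrow> S \<subseteq> I \<Longrightarrow> (\<Sum>K\<in>\<D>. Sup K - Inf K) < \<delta> \<Longrightarrow>
       (\<Sum>K\<in>\<D>. norm (x (Sup K) - x (Inf K))) < e"
proof -
  obtain \<delta> where "\<delta> > 0" and \<delta>: "\<forall>\<D> S. \<D> division_of S \<and> S \<subseteq> I \<and> (\<Sum>K\<in>\<D>. Sup K - Inf K) < \<delta> \<longrightarrow>
       (\<Sum>K\<in>\<D>. norm (x (Sup K) - x (Inf K))) < e"
    using assms(1)[unfolded absolutely_continuous_on_def, rule_format, OF assms(2)] by (elim exE conjE)
  then show thesis by (intro that[of \<delta>]) auto
qed

text \<open>Two different pairs with the same interval would give it empty interior, so it would be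
  a single point, equal to both tags. This lets sums over tagged pairs become sums over intervals,
  the form in which absolute continuity is stated.\<close>

lemma tagged_partial_division_inj_on_snd:
  fixes q :: "(real \<times> real set) set"
  assumes "q tagged_partial_division_of S"
  shows "inj_on snd q"
proof (rule inj_onI)
  fix u v assume uv: "u \<in> q" "v \<in> q" "snd u = snd v"
  obtain x y K where [simp]: "u = (x, K)" "v = (y, K)"
    using uv(3) by (metis prod.collapse)
  note D = tagged_partial_division_ofD[OF assms]
  show "u = v"
  proof (rule ccontr)
    assume ne: "u \<noteq> v"
    then have "interior K = {}"
      using D(5)[of x K y K] uv by auto
    moreover obtain a b where "K = cbox a b"
      using D(4)[of x K] uv by auto
    ultimately have "K = {a..b}" "{a<..<b} = {}"
      by auto
    then show False
      using D(2)[of x K] D(2)[of y K] uv ne by force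
  qed
qed

text \<open>
  In a fine tagged partition, the intervals tagged in \<open>N\<close> lie in an open set of small measure, where
  absolute continuity controls the increments; on the others the derivative does.
\<close>

lemma absolutely_continuous_on_increment_le:
  fixes f :: "real \<Rightarrow> real"
  assumes ab: "a \<le> b" and ac: "absolutely_continuous_on {a..b} f" and N: "negligible N"
    and der: "\<And>t. t \<in> {a..b} - N \<Longrightarrow>
                \<exists>f'. (f has_real_derivative f') (at t within {a..b}) \<and> f' \<le> c"
  shows "f b - f a \<le> c * (b - a)"
proof (rule field_le_epsilon)
  fix e :: real assume e: "e > 0"
  \<comment> \<open>\<open>e1\<close> is the slack in the slope; over \<open>{a..b}\<close> it costs
    at most \<open>e / 4\<close>, and the \<open>+ 1\<close> covers \<open>a = b\<close>.\<close>
  define e1 where "e1 = e / (4 * (b - a + 1))"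
  have e1: "e1 > 0" "e1 * (b - a) \<le> e / 4"
    using e ab by (auto simp: e1_def field_simps)
  obtain \<delta> where \<delta>: "\<delta> > 0"
    and ac': "\<And>\<D> S. \<D> division_of S \<Longrightarrow> S \<subseteq> {a..b} \<Longrightarrow> (\<Sum>K\<in>\<D>. Sup K - Inf K) < \<delta> \<Longrightarrow>
       (\<Sum>K\<in>\<D>. norm (f (Sup K) - f (Inf K))) < e / 4"
    using absolutely_continuous_onE[OF ac, of "e/4"] e by auto
  \<comment> \<open>Total length below \<open>\<delta>\<close> controls the increments of the
    exceptional intervals; the second bound makes \<open>\<bar>c + e1\<bar>\<close> times that
    length at most \<open>e / 4\<close>.\<close>
  define \<mu> where "\<mu> = min \<delta> (e / (4 * (\<bar>c + e1\<bar> + 1)))"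
  have "e / (4 * (\<bar>c + e1\<bar> + 1)) > 0"
    using e by (intro divide_pos_pos mult_pos_pos) (auto intro: add_nonneg_pos)
  then have \<mu>: "\<mu> > 0" using \<delta> by (simp add: \<mu>_def)
  obtain U where U: "open U" "N \<subseteq> U" "U \<in> lmeasurable" "measure lebesgue U < \<mu>"
    using negligible_outer_open[OF N \<mu>] by metis
  \<comment> \<open>The interval straddles the tag: for \<open>u \<le> t \<le> v\<close> the errors
    at \<open>u\<close> and \<open>v\<close> add up to \<open>e1 * (v - u)\<close>, which is
    proportional to the length of the interval.\<close>
  have "\<exists>r>0. \<forall>u v. u \<in> {a..b} \<and> v \<in> {a..b} \<and> u \<le> t \<and> t \<le> v \<and> u \<in> ball t r \<and> v \<in> ball t r \<longrightarrow>
             f v - f u \<le> (c + e1) * (v - u)" if t: "t \<in> {a..b} - N" for t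
  proof -
    obtain f' where f': "(f has_real_derivative f') (at t within {a..b})" "f' \<le> c"
      using der[OF t] by blast
    obtain r where r: "r > 0"
      "\<And>y. y \<in> {a..b} \<Longrightarrow> norm (y - t) < r \<Longrightarrow> norm (f y - f t - f' * (y - t)) \<le> e1 * norm (y - t)"
      using f'(1) e1(1) unfolding has_field_derivative_def has_derivative_within_alt by blast
    show ?thesis
    proof (intro exI conjI allI impI)
      show "r > 0" by fact
      fix u v assume uv: "u \<in> {a..b} \<and> v \<in> {a..b} \<and> u \<le> t \<and> t \<le> v \<and> u \<in> ball t r \<and> v \<in> ball t r"
      then have "norm (v - t) < r" "norm (u - t) < r"
        by (auto simp: dist_real_def)
      then have "norm (f v - f t - f' * (v - t)) \<le> e1 * norm (v - t)"
        "norm (f u - f t - f' * (u - t)) \<le> e1 * norm (u - t)"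
        using uv r(2) by blast+
      then have "f v - f t - f' * (v - t) \<le> e1 * (v - t)" "- (f u - f t - f' * (u - t)) \<le> e1 * (t - u)"
        using uv by (auto simp: abs_le_iff)
      then have "f v - f u \<le> (f' + e1) * (v - u)"
        by (simp add: algebra_simps)
      also have "\<dots> \<le> (c + e1) * (v - u)"
        using uv f'(2) by (intro mult_right_mono) auto
      finally show "f v - f u \<le> (c + e1) * (v - u)" .
    qed
  qed
  then obtain r where r: "\<And>t. t \<in> {a..b} - N \<Longrightarrow> r t > 0"
    "\<And>t u v. t \<in> {a..b} - N \<Longrightarrow> u \<in> {a..b} \<Longrightarrow> v \<in> {a..b} \<Longrightarrow> u \<le> t \<Longrightarrow> t \<le> v \<Longrightarrow>
       u \<in> ball t (r t) \<Longrightarrow> v \<in> ball t (r t) \<Longrightarrow> f v - f u \<le> (c + e1) * (v - u)"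
    by metis
  \<comment> \<open>At exceptional tags the gauge is \<open>U\<close> itself, which forces their
    intervals into \<open>U\<close>; the value off \<open>{a..b}\<close> only makes \<open>G\<close>
    a gauge on the whole line.\<close>
  define G where "G t = (if t \<in> N then U else if t \<in> {a..b} then ball t (r t) else ball t 1)" for t
  have "gauge G"
    using U r(1) by (auto simp: gauge_def G_def)
  then obtain p where p: "p tagged_division_of {a..b}" "G fine p"
    using fine_division_exists_real by blast
  define q where "q = {z \<in> p. fst z \<in> N}"
  have pp: "p tagged_partial_division_of {a..b}"
    using p(1) by (simp add: tagged_division_of_def)
  have qp: "q tagged_partial_division_of {a..b}"
    by (rule tagged_partial_division_subset[OF pp]) (auto simp: q_def)
  have finp: "finite p" using p(1) by blast
  have cases_K: "\<exists>u v. K = {u..v} \<and> u \<le> x \<and> x \<le> v \<and> u \<in> {a..b} \<and> v \<in> {a..b} \<and> Sup K = v \<and> Inf K = u"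
    if xK: "(x, K) \<in> p" for x K
  proof -
    obtain u v where K: "K = {u..v}" using tagged_partial_division_ofD(4)[OF pp xK] by auto
    with tagged_partial_division_ofD(2,3)[OF pp xK] show ?thesis by auto
  qed
  let ?len = "\<lambda>z::real \<times> real set. Sup (snd z) - Inf (snd z)"
  let ?df = "\<lambda>z::real \<times> real set. f (Sup (snd z)) - f (Inf (snd z))"
  have div: "snd ` q division_of \<Union>(snd ` q)"
    by (rule partial_division_of_tagged_division[OF qp])
  have sub: "\<Union>(snd ` q) \<subseteq> {a..b}"
  proof (rule Union_least)
    fix K assume "K \<in> snd ` q"
    then obtain x where "(x, K) \<in> q" by auto
    then show "K \<subseteq> {a..b}" by (rule tagged_partial_division_ofD(3)[OF qp])
  qed
  have subU: "\<Union>(snd ` q) \<subseteq> U"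
  proof (rule Union_least)
    fix K assume "K \<in> snd ` q"
    then obtain x where "(x, K) \<in> p" "x \<in> N" by (auto simp: q_def)
    then show "K \<subseteq> U" using fineD[OF p(2), of x K] by (simp add: G_def)
  qed
  have inj: "inj_on snd q" by (rule tagged_partial_division_inj_on_snd[OF qp])
  have "(\<Sum>K\<in>snd ` q. Sup K - Inf K) = (\<Sum>K\<in>snd ` q. measure lebesgue K)"
  proof (rule sum.cong[OF refl])
    fix K assume "K \<in> snd ` q"
    then obtain x where "(x, K) \<in> p" by (auto simp: q_def)
    from cases_K[OF this] obtain u v where "K = {u..v}" "u \<le> v" by (metis order_trans)
    then show "Sup K - Inf K = measure lebesgue K" by simp
  qed
  also have "\<dots> = measure lebesgue (\<Union>(snd ` q))"
    by (rule content_division[OF div])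
  also have "\<dots> \<le> measure lebesgue U"
    using subU U(3) lmeasurable_division[OF div] by (intro measure_mono_fmeasurable) auto
  finally have len: "(\<Sum>K\<in>snd ` q. Sup K - Inf K) < \<mu>"
    using U(4) by linarith
  then have dfq: "(\<Sum>K\<in>snd ` q. norm (f (Sup K) - f (Inf K))) < e / 4"
    using ac'[OF div sub] by (simp add: \<mu>_def)
  have lenq: "(\<Sum>z\<in>q. ?len z) < \<mu>" and dfq': "(\<Sum>z\<in>q. \<bar>?df z\<bar>) < e / 4"
    using len dfq by (simp_all add: sum.reindex[OF inj])
  have "f b - f a = (\<Sum>z\<in>p. ?df z)"
    using additive_tagged_division_1[OF ab p(1), of f] by (simp add: case_prod_beta)
  \<comment> \<open>The main term is kept on every interval so that the lengths telescope to
    \<open>b - a\<close>. On exceptional intervals \<open>c + e1\<close> may be negative, which the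
    added \<open>\<bar>c + e1\<bar>\<close> times the length offsets.\<close>
  also have "\<dots> \<le> (\<Sum>z\<in>p. (c + e1) * ?len z + (if fst z \<in> N then \<bar>?df z\<bar> + \<bar>c + e1\<bar> * ?len z else 0))"
  proof (rule sum_mono)
    fix z assume z: "z \<in> p"
    obtain x K where zz: "z = (x, K)" by fastforce
    obtain u v where uv: "K = {u..v}" "u \<le> x" "x \<le> v" "u \<in> {a..b}" "v \<in> {a..b}" "Sup K = v" "Inf K = u"
      using cases_K z zz by blast
    show "?df z \<le> (c + e1) * ?len z + (if fst z \<in> N then \<bar>?df z\<bar> + \<bar>c + e1\<bar> * ?len z else 0)"
    proof (cases "x \<in> N")
      case True
      have "(c + e1) * (v - u) + \<bar>c + e1\<bar> * (v - u) = (c + e1 + \<bar>c + e1\<bar>) * (v - u)"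
        by (simp add: algebra_simps)
      also have "\<dots> \<ge> 0" using uv by (intro mult_nonneg_nonneg) auto
      finally show ?thesis using True uv zz by auto
    next
      case False
      have K: "x \<in> {a..b}" "u \<in> K" "v \<in> K" using uv by auto
      have "K \<subseteq> G x" using fineD[OF p(2)] z zz by blast
      then have "K \<subseteq> ball x (r x)" using False K(1) by (simp add: G_def)
      then have "u \<in> ball x (r x)" "v \<in> ball x (r x)"
        using K by blast+
      then have "f v - f u \<le> (c + e1) * (v - u)"
        using False uv by (intro r(2)[of x]) auto
      then show ?thesis using False uv zz by auto
    qed
  qed
  also have "\<dots> = (c + e1) * (\<Sum>z\<in>p. ?len z) + ((\<Sum>z\<in>q. \<bar>?df z\<bar>) + \<bar>c + e1\<bar> * (\<Sum>z\<in>q. ?len z))"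
  proof -
    have "(\<Sum>z\<in>p. if fst z \<in> N then \<bar>?df z\<bar> + \<bar>c + e1\<bar> * ?len z else 0)
        = (\<Sum>z\<in>q. \<bar>?df z\<bar> + \<bar>c + e1\<bar> * ?len z)"
      unfolding q_def using finp by (rule sum.inter_filter[symmetric])
    then show ?thesis by (simp add: sum.distrib flip: sum_distrib_left)
  qed
  also have "(\<Sum>z\<in>p. ?len z) = b - a"
    using additive_tagged_division_1[OF ab p(1), of "\<lambda>x. x"] by (simp add: case_prod_beta)
  also have "(c + e1) * (b - a) + ((\<Sum>z\<in>q. \<bar>?df z\<bar>) + \<bar>c + e1\<bar> * (\<Sum>z\<in>q. ?len z))
      \<le> (c + e1) * (b - a) + (e / 4 + e / 4)"
  proof -
    have "C * (e / (4 * (C + 1))) \<le> e / 4" if "C \<ge> 0" for C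
      using e that by (simp add: field_simps)
    from this[of "\<bar>c + e1\<bar>"] have *: "\<bar>c + e1\<bar> * (e / (4 * (\<bar>c + e1\<bar> + 1))) \<le> e / 4"
      by simp
    have "\<bar>c + e1\<bar> * (\<Sum>z\<in>q. ?len z) \<le> \<bar>c + e1\<bar> * (e / (4 * (\<bar>c + e1\<bar> + 1)))"
      using lenq by (intro mult_left_mono) (auto simp: \<mu>_def)
    also note *
    finally show ?thesis using dfq' by linarith
  qed
  also have "\<dots> \<le> c * (b - a) + e"
    using e1(2) e by (simp add: algebra_simps)
  finally show "f b - f a \<le> c * (b - a) + e" .
qed

lemma absolutely_continuous_on_bounded_linear:
  assumes ac: "absolutely_continuous_on I x" and h: "bounded_linear h"
  shows "absolutely_continuous_on I (\<lambda>t. h (x t))"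
  unfolding absolutely_continuous_on_def
proof (intro allI impI)
  fix e :: real assume e: "e > 0"
  interpret h: bounded_linear h by fact
  obtain B where B: "B > 0" "\<And>v. norm (h v) \<le> norm v * B"
    using h.pos_bounded by blast
  obtain \<delta> where \<delta>: "\<delta> > 0"
    "\<And>\<D> S. \<D> division_of S \<Longrightarrow> S \<subseteq> I \<Longrightarrow> (\<Sum>K\<in>\<D>. Sup K - Inf K) < \<delta> \<Longrightarrow>
       (\<Sum>K\<in>\<D>. norm (x (Sup K) - x (Inf K))) < e / B"
    using absolutely_continuous_onE[OF ac, of "e / B"] e B by auto
  show "\<exists>\<delta>>0. \<forall>\<D> S. \<D> division_of S \<and> S \<subseteq> I \<and> (\<Sum>K\<in>\<D>. Sup K - Inf K) < \<delta> \<longrightarrow>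
      (\<Sum>K\<in>\<D>. norm (h (x (Sup K)) - h (x (Inf K)))) < e"
  proof (intro exI conjI allI impI)
    fix \<D> S assume A: "\<D> division_of S \<and> S \<subseteq> I \<and> (\<Sum>K\<in>\<D>. Sup K - Inf K) < \<delta>"
    have "(\<Sum>K\<in>\<D>. norm (h (x (Sup K)) - h (x (Inf K)))) \<le> (\<Sum>K\<in>\<D>. norm (x (Sup K) - x (Inf K)) * B)"
      by (intro sum_mono) (metis B(2) h.diff)
    also have "\<dots> < e"
      using \<delta>(2)[of \<D> S] A B by (simp add: sum_distrib_right[symmetric] pos_less_divide_eq)
    finally show "(\<Sum>K\<in>\<D>. norm (h (x (Sup K)) - h (x (Inf K)))) < e" .
  qed (fact \<delta>)
qed

lemma division_of_real_interval:
  assumes "\<D> division_of (S::real set)" "K \<in> \<D>"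
  shows "Inf K \<le> Sup K" "Inf K \<in> S" "Sup K \<in> S"
proof -
  obtain a b where "K = cbox a b" "K \<noteq> {}" "K \<subseteq> S"
    using division_ofD[OF assms(1)] assms(2) by metis
  then show "Inf K \<le> Sup K" "Inf K \<in> S" "Sup K \<in> S" by auto
qed

text \<open>The continuation of a solution is constructed as a Lipschitz function; this is how it
  meets the absolute continuity asked of solutions.\<close>

lemma lipschitz_on_imp_absolutely_continuous_on:
  assumes "L-lipschitz_on I x"
  shows "absolutely_continuous_on I x"
  unfolding absolutely_continuous_on_def
proof (intro allI impI)
  fix e :: real assume e: "e > 0"
  have L: "L \<ge> 0" using assms lipschitz_on_nonneg by blast
  show "\<exists>\<delta>>0. \<forall>\<D> S. \<D> division_of S \<and> S \<subseteq> I \<and> (\<Sum>K\<in>\<D>. Sup K - Inf K) < \<delta> \<longrightarrow>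
      (\<Sum>K\<in>\<D>. norm (x (Sup K) - x (Inf K))) < e"
  proof (intro exI conjI allI impI)
    show "e / (L + 1) > 0" using e L by simp
    fix \<D> S assume A: "\<D> division_of S \<and> S \<subseteq> I \<and> (\<Sum>K\<in>\<D>. Sup K - Inf K) < e / (L + 1)"
    have "(\<Sum>K\<in>\<D>. norm (x (Sup K) - x (Inf K))) \<le> (\<Sum>K\<in>\<D>. L * (Sup K - Inf K))"
    proof (rule sum_mono)
      fix K assume "K \<in> \<D>"
      then have "Inf K \<le> Sup K" "Inf K \<in> I" "Sup K \<in> I"
        using division_of_real_interval[of \<D> S K] A by auto
      then show "norm (x (Sup K) - x (Inf K)) \<le> L * (Sup K - Inf K)"
        using lipschitz_on_normD[OF assms, of "Sup K" "Inf K"] by simp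
    qed
    also have "\<dots> = L * (\<Sum>K\<in>\<D>. Sup K - Inf K)" by (simp add: sum_distrib_left)
    also have "\<dots> \<le> L * (e / (L + 1))" using A L by (intro mult_left_mono) auto
    also have "\<dots> < e" using e L by (simp add: field_simps)
    finally show "(\<Sum>K\<in>\<D>. norm (x (Sup K) - x (Inf K))) < e" .
  qed
qed

lemma absolutely_continuous_on_imp_continuous_on:
  assumes ac: "absolutely_continuous_on {a..b} x"
  shows "continuous_on {a..b} x"
  unfolding continuous_on_iff
proof (intro ballI allI impI)
  fix s e :: real assume s: "s \<in> {a..b}" and e: "e > 0"
  obtain \<delta> where \<delta>: "\<delta> > 0"
    "\<And>\<D> S. \<D> division_of S \<Longrightarrow> S \<subseteq> {a..b} \<Longrightarrow> (\<Sum>K\<in>\<D>. Sup K - Inf K) < \<delta> \<Longrightarrow>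
       (\<Sum>K\<in>\<D>. norm (x (Sup K) - x (Inf K))) < e"
    using absolutely_continuous_onE[OF ac e] by metis
  have *: "norm (x v - x u) < e" if "a \<le> u" "u \<le> v" "v \<le> b" "v - u < \<delta>" for u v
  proof -
    have "{{u..v}} division_of {u..v}"
      using that division_of_self[of u v] by auto
    from \<delta>(2)[OF this] that show ?thesis by simp
  qed
  show "\<exists>d>0. \<forall>t\<in>{a..b}. dist t s < d \<longrightarrow> dist (x t) (x s) < e"
  proof (intro exI conjI ballI impI)
    fix t assume t: "t \<in> {a..b}" "dist t s < \<delta>"
    show "dist (x t) (x s) < e"
      using *[of s t] *[of t s] s t by (cases "s \<le> t") (auto simp: dist_norm norm_minus_commute)
  qed (fact \<delta>)
qed

text \<open>The increment \<open>v\<close> is itself the direction to test with: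
  \<open>v \<bullet> x\<close> reduces the claim to the scalar estimate with slope
  \<open>norm v * B\<close>, and one factor \<open>norm v\<close> cancels.\<close>

lemma absolutely_continuous_on_norm_increment_le:
  fixes x :: "real \<Rightarrow> 'a::real_inner"
  assumes ab: "a \<le> b" and ac: "absolutely_continuous_on {a..b} x" and N: "negligible N"
    and der: "\<And>t. t \<in> {a..b} - N \<Longrightarrow>
                \<exists>x'. (x has_vector_derivative x') (at t within {a..b}) \<and> norm x' \<le> B"
  shows "norm (x b - x a) \<le> B * (b - a)"
proof (cases "x b = x a")
  case False
  define v where "v = x b - x a"
  have "v \<bullet> x b - v \<bullet> x a \<le> norm v * B * (b - a)"
  proof (rule absolutely_continuous_on_increment_le[OF ab _ N])
    show "absolutely_continuous_on {a..b} (\<lambda>t. v \<bullet> x t)"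
      by (rule absolutely_continuous_on_bounded_linear[OF ac bounded_linear_inner_right])
    fix t assume "t \<in> {a..b} - N"
    then obtain x' where x': "(x has_vector_derivative x') (at t within {a..b})" "norm x' \<le> B"
      using der by blast
    have "((\<lambda>t. v \<bullet> x t) has_real_derivative v \<bullet> x') (at t within {a..b})"
      using bounded_linear.has_vector_derivative[OF bounded_linear_inner_right x'(1)]
      by (simp add: has_real_derivative_iff_has_vector_derivative)
    moreover have "v \<bullet> x' \<le> norm v * B"
      using norm_cauchy_schwarz[of v x'] x'(2) by (meson mult_left_mono norm_ge_zero order_trans)
    ultimately show "\<exists>f'. ((\<lambda>t. v \<bullet> x t) has_real_derivative f') (at t within {a..b}) \<and> f' \<le> norm v * B"
      by blast
  qed
  then have "norm v * norm v \<le> norm v * (B * (b - a))"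
    by (simp add: v_def inner_diff_right[symmetric] dot_square_norm power2_eq_square mult.assoc)
  then show ?thesis
    using False by (simp add: v_def)
next
  case True
  \<comment> \<open>The sign of \<open>B\<close> has to be derived: a nondegenerate interval is not
    negligible, so it contains a point where \<open>norm x' \<le> B\<close>.\<close>
  have "0 \<le> B * (b - a)"
  proof (cases "a = b")
    case False
    have "\<not> {a..b} \<subseteq> N"
      using negligible_subset[OF N] False ab negligible_interval(1)[of a b] by auto
    then obtain t where "t \<in> {a..b} - N" by blast
    then have "B \<ge> 0" using der norm_ge_zero order_trans by blast
    then show ?thesis using ab by simp
  qed simp
  then show ?thesis using True by simp
qed

section \<open>Lebesgue differentiation on the line\<close>

text \<open>Splits the derivative into forward and backward increments, the form in which averages
  over intervals deliver it.\<close>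

lemma has_vector_derivative_atI_increments:
  fixes \<Phi> :: "real \<Rightarrow> 'a::real_normed_vector"
  assumes incr: "\<And>e. e > 0 \<Longrightarrow> \<exists>d>0. \<forall>h. 0 < h \<and> h < d \<longrightarrow>
      norm (\<Phi> (t + h) - \<Phi> t - h *\<^sub>R v) \<le> e * h \<and> norm (\<Phi> t - \<Phi> (t - h) - h *\<^sub>R v) \<le> e * h"
  shows "(\<Phi> has_vector_derivative v) (at t)"
  unfolding has_vector_derivative_def has_derivative_within_alt
proof (intro conjI allI impI)
  show "bounded_linear (\<lambda>x. x *\<^sub>R v)" by (rule bounded_linear_scaleR_left)
  fix e :: real assume "e > 0"
  obtain d where d: "d > 0" "\<And>h. 0 < h \<Longrightarrow> h < d \<Longrightarrow>
      norm (\<Phi> (t + h) - \<Phi> t - h *\<^sub>R v) \<le> e * h \<and> norm (\<Phi> t - \<Phi> (t - h) - h *\<^sub>R v) \<le> e * h"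
    using incr[OF \<open>e > 0\<close>] by blast
  show "\<exists>d>0. \<forall>y\<in>UNIV. norm (y - t) < d \<longrightarrow> norm (\<Phi> y - \<Phi> t - (y - t) *\<^sub>R v) \<le> e * norm (y - t)"
  proof (intro exI conjI ballI impI)
    fix y assume y: "norm (y - t) < d"
    consider "y = t" | "y > t" | "y < t" by linarith
    then show "norm (\<Phi> y - \<Phi> t - (y - t) *\<^sub>R v) \<le> e * norm (y - t)"
    proof cases
      case 2
      then show ?thesis using d(2)[of "y - t"] y by simp
    next
      case 3
      have "\<Phi> y - \<Phi> t - (y - t) *\<^sub>R v = - (\<Phi> t - \<Phi> y - (t - y) *\<^sub>R v)"
        by (simp add: algebra_simps)
      then show ?thesis using 3 d(2)[of "t - y"] y by (simp only: norm_minus_cancel) simp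
    qed simp
  qed (fact d)
qed

text \<open>\<open>integrable_ccontinuous_explicit\<close> speaks of averages over cubes with lower
  corner \<open>t\<close>; on the line such a cube is \<open>{t..t + h}\<close>, and multiplying by
  \<open>h\<close> turns the average into an increment.\<close>

lemma lebesgue_differentiation_right:
  fixes f :: "real \<Rightarrow> 'a::euclidean_space"
  assumes "\<And>a b. f integrable_on {a..b}"
  obtains N where "negligible N"
    "\<And>t e. t \<notin> N \<Longrightarrow> e > 0 \<Longrightarrow>
       \<exists>d>0. \<forall>h. 0 < h \<and> h < d \<longrightarrow> norm (integral {t..t + h} f - h *\<^sub>R f t) \<le> e * h"
proof -
  obtain N where N: "negligible N" "\<And>t e. \<lbrakk>t \<notin> N; 0 < e\<rbrakk> \<Longrightarrow>
       \<exists>d>0. \<forall>h. 0 < h \<and> h < d \<longrightarrow>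
         norm (integral (cbox t (t + h *\<^sub>R One)) f /\<^sub>R h ^ DIM(real) - f t) < e"
    using integrable_ccontinuous_explicit[of f] assms by (metis box_real(2))
  show thesis
  proof (rule that[OF N(1)])
    fix t e :: real assume "t \<notin> N" "e > 0"
    then obtain d where d: "d > 0" "\<And>h. 0 < h \<Longrightarrow> h < d \<Longrightarrow>
         norm (integral {t..t + h} f /\<^sub>R h - f t) < e"
      using N(2)[of t e] by auto
    have "norm (integral {t..t + h} f - h *\<^sub>R f t) \<le> e * h" if "0 < h" "h < d" for h
    proof -
      have "integral {t..t + h} f - h *\<^sub>R f t = h *\<^sub>R (integral {t..t + h} f /\<^sub>R h - f t)"
        using that by (simp add: algebra_simps)
      then have "norm (integral {t..t + h} f - h *\<^sub>R f t) = h * norm (integral {t..t + h} f /\<^sub>R h - f t)"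
        using that by simp
      also have "\<dots> \<le> h * e" using d(2)[OF that] that by (intro mult_left_mono) auto
      finally show ?thesis by (simp add: mult.commute)
    qed
    then show "\<exists>d>0. \<forall>h. 0 < h \<and> h < d \<longrightarrow> norm (integral {t..t + h} f - h *\<^sub>R f t) \<le> e * h"
      using d(1) by blast
  qed
qed

text \<open>The left derivative is the right derivative of the reflected function.\<close>

theorem lebesgue_differentiation_real:
  fixes f :: "real \<Rightarrow> 'a::euclidean_space"
  assumes f: "\<And>a b. f integrable_on {a..b}"
  obtains N where "negligible N"
    "\<And>t a. t \<notin> N \<Longrightarrow> a < t \<Longrightarrow> ((\<lambda>u. integral {a..u} f) has_vector_derivative f t) (at t)"
proof -
  have g: "(\<lambda>s. f (- s)) integrable_on {a..b}" for a b
    using f[of "-b" "-a"] Henstock_Kurzweil_Integration.integrable_reflect_real[of f "-a" "-b"]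
    by (simp only: minus_minus)
  obtain N where N: "negligible N"
    "\<And>t e. t \<notin> N \<Longrightarrow> e > 0 \<Longrightarrow>
       \<exists>d>0. \<forall>h. 0 < h \<and> h < d \<longrightarrow> norm (integral {t..t + h} f - h *\<^sub>R f t) \<le> e * h"
    using lebesgue_differentiation_right[OF f] by metis
  obtain M where M: "negligible M"
    "\<And>t e. t \<notin> M \<Longrightarrow> e > 0 \<Longrightarrow>
       \<exists>d>0. \<forall>h. 0 < h \<and> h < d \<longrightarrow> norm (integral {t..t + h} (\<lambda>s. f (- s)) - h *\<^sub>R f (- t)) \<le> e * h"
    using lebesgue_differentiation_right[of "\<lambda>s. f (- s)"] g by metis
  show thesis
  proof (rule that[of "N \<union> uminus ` M"])
    have "negligible (uminus ` M)"
      using M(1)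
      by (intro negligible_differentiable_image_negligible) (auto intro!: derivative_intros)
    then show "negligible (N \<union> uminus ` M)" using N(1) by simp
    fix t a :: real assume t: "t \<notin> N \<union> uminus ` M" and a: "a < t"
    have M': "- t \<notin> M" using t by force
    show "((\<lambda>u. integral {a..u} f) has_vector_derivative f t) (at t)"
    proof (rule has_vector_derivative_atI_increments)
      fix e :: real assume e: "e > 0"
      obtain d1 where d1: "d1 > 0" "\<And>h. 0 < h \<Longrightarrow> h < d1 \<Longrightarrow> norm (integral {t..t + h} f - h *\<^sub>R f t) \<le> e * h"
        using N(2)[of t e] t e by auto
      obtain d2 where d2: "d2 > 0"
        "\<And>h. 0 < h \<Longrightarrow> h < d2 \<Longrightarrow> norm (integral {- t..- t + h} (\<lambda>s. f (- s)) - h *\<^sub>R f t) \<le> e * h"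
        using M(2)[OF M' e] by auto
      show "\<exists>d>0. \<forall>h. 0 < h \<and> h < d \<longrightarrow>
          norm (integral {a..t + h} f - integral {a..t} f - h *\<^sub>R f t) \<le> e * h \<and>
          norm (integral {a..t} f - integral {a..t - h} f - h *\<^sub>R f t) \<le> e * h"
      proof (intro exI conjI allI impI)
        \<comment> \<open>\<open>h < t - a\<close> keeps \<open>t - h\<close> to the right of
          \<open>a\<close>, so that both integrals can be split.\<close>
        show "min (min d1 d2) (t - a) > 0" using d1 d2 a by simp
        fix h assume h: "0 < h \<and> h < min (min d1 d2) (t - a)"
        have 1: "integral {a..t} f + integral {t..t + h} f = integral {a..t + h} f"
          using h a f by (intro Henstock_Kurzweil_Integration.integral_combine) auto
        have 2: "integral {a..t - h} f + integral {t - h..t} f = integral {a..t} f"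
          using h a f by (intro Henstock_Kurzweil_Integration.integral_combine) auto
        \<comment> \<open>The right increment of the reflected function at \<open>- t\<close> is the
          left increment of the original one at \<open>t\<close>.\<close>
        have 3: "integral {- t..- t + h} (\<lambda>s. f (- s)) = integral {t - h..t} f"
          using Henstock_Kurzweil_Integration.integral_reflect_real[of t "t - h" f]
          by (simp only: minus_diff_eq diff_conv_add_uminus add.commute minus_add_distrib minus_minus)
        show "norm (integral {a..t + h} f - integral {a..t} f - h *\<^sub>R f t) \<le> e * h"
          using d1(2)[of h] h by (simp add: 1[symmetric])
        show "norm (integral {a..t} f - integral {a..t - h} f - h *\<^sub>R f t) \<le> e * h"
          using d2(2)[of h] h unfolding 2[symmetric] 3 by simp
      qed
    qed
  qed
qed

lemma norm_integral_le_real: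
  fixes f :: "real \<Rightarrow> 'a::real_normed_vector"
  assumes "a \<le> b" "f integrable_on {a..b}" "0 \<le> B" "\<And>t. t \<in> {a..b} \<Longrightarrow> norm (f t) \<le> B"
  shows "norm (integral {a..b} f) \<le> B * (b - a)"
  using integrable_bound[of B f a b] assms by simp

section \<open>Caratheodory solutions\<close>

lemma borel_measurable_along_signal:
  fixes F :: "'a::euclidean_space \<Rightarrow> 'd::euclidean_space \<Rightarrow> 'b::euclidean_space"
  assumes cont: "continuous_on UNIV (\<lambda>(x, d). F x d)"
    and d: "d \<in> borel_measurable M" and z: "z \<in> borel_measurable M"
  shows "(\<lambda>s. F (z s) (d s)) \<in> borel_measurable M"
proof -
  have "(\<lambda>(x, d). F x d) \<in> borel_measurable borel"
    using cont by (intro borel_measurable_continuous_onI) auto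
  moreover have "(\<lambda>s. (z s, d s)) \<in> borel_measurable M"
    using z d by (rule borel_measurable_Pair)
  ultimately have "(\<lambda>s. (\<lambda>(x, d). F x d) (z s, d s)) \<in> borel_measurable M"
    by (rule measurable_compose[rotated])
  then show ?thesis by simp
qed

text \<open>Banach's fixed point theorem applied to the integral equation on a short time interval.\<close>

theorem caratheodory_existence_globally_lipschitz:
  fixes F :: "'a::euclidean_space \<Rightarrow> 'd::euclidean_space \<Rightarrow> 'a"
  assumes cont: "continuous_on UNIV (\<lambda>(x, d). F x d)"
    and lip: "\<And>d. d \<in> D \<Longrightarrow> L-lipschitz_on UNIV (\<lambda>x. F x d)"
    and bound: "\<And>x d. d \<in> D \<Longrightarrow> norm (F x d) \<le> B"
    and d: "disturbance_signal D d"
    and T: "T \<ge> 0" and h: "h > 0" "h * L < 1"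
  obtains z N where "z T = x0" "B-lipschitz_on {T..T + h} z" "negligible N"
    "\<And>t. t \<in> {T<..<T + h} - N \<Longrightarrow> (z has_vector_derivative F (z t) (d t)) (at t)"
proof -
  let ?I = "{T..T + h}"
  have dD: "d t \<in> D" if "t \<ge> 0" for t using d that by (simp add: disturbance_signal_def)
  have B: "B \<ge> 0" using bound[of "d 0" undefined] dD[of 0] norm_ge_zero order_trans by blast
  have L: "L \<ge> 0" using lip[of "d 0"] dD[of 0] lipschitz_on_nonneg by auto
  have dm: "d \<in> borel_measurable (lebesgue_on ?I)"
    using d T unfolding disturbance_signal_def
    by (auto intro: measurable_restrict_mono)
  have int: "(\<lambda>s. F (z s) (d s)) integrable_on {a..b}" if z: "continuous_on UNIV z" and ab: "T \<le> a" "b \<le> T + h"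
    for z a b
  proof -
    have "(\<lambda>s. F (z s) (d s)) integrable_on ?I"
    proof (rule measurable_bounded_by_integrable_imp_integrable)
      have "z \<in> borel_measurable (lebesgue_on ?I)"
        by (rule continuous_imp_measurable_on_sets_lebesgue) (auto intro: continuous_on_subset[OF z])
      then show "(\<lambda>s. F (z s) (d s)) \<in> borel_measurable (lebesgue_on ?I)"
        by (rule borel_measurable_along_signal[OF cont dm])
      show "(\<lambda>s. B) integrable_on ?I" by (rule integrable_const_ivl)
      show "norm (F (z s) (d s)) \<le> B" if "s \<in> ?I" for s
        using that T by (intro bound dD) auto
    qed auto
    then show ?thesis
      by (rule integrable_on_subinterval) (use ab in auto)
  qed
  define \<Phi> where "\<Phi> z t = x0 + integral {T..t} (\<lambda>s. F (z s) (d s))" for z t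
  have \<Phi>lip: "B-lipschitz_on ?I (\<Phi> z)" if z: "continuous_on UNIV z" for z
  proof (rule lipschitz_on_leI)
    fix s t assume st: "s \<in> ?I" "t \<in> ?I" "s \<le> t"
    have "integral {T..s} (\<lambda>s. F (z s) (d s)) + integral {s..t} (\<lambda>s. F (z s) (d s)) = integral {T..t} (\<lambda>s. F (z s) (d s))"
      using st int[OF z] by (intro Henstock_Kurzweil_Integration.integral_combine) auto
    then have "dist (\<Phi> z s) (\<Phi> z t) = norm (integral {s..t} (\<lambda>s. F (z s) (d s)))"
      by (simp add: \<Phi>_def dist_norm norm_minus_commute flip: add_diff_eq)
         (metis add_diff_cancel_left' norm_minus_commute)
    also have "\<dots> \<le> B * (t - s)"
      using st T int[OF z, of s t] by (intro norm_integral_le_real B bound dD) auto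
    finally show "dist (\<Phi> z s) (\<Phi> z t) \<le> B * dist s t"
      using st by (simp add: dist_real_def)
  qed (fact B)
  have proj: "clamp T (T + h) t \<in> ?I" for t
    using clamp_in_interval[of T "T + h" t] h by simp
  \<comment> \<open>The contraction acts on bounded continuous functions on the whole line, a
    complete space. Clamping the time freezes \<open>\<Phi> z\<close> at its end values outside
    \<open>?I\<close>, which makes the image bounded and continuous.\<close>
  define \<Psi> where "\<Psi> z = Bcontfun (\<lambda>t. \<Phi> (apply_bcontfun z) (clamp T (T + h) t))" for z :: "real \<Rightarrow>\<^sub>C 'a"
  have \<Psi>: "apply_bcontfun (\<Psi> z) t = \<Phi> (apply_bcontfun z) (clamp T (T + h) t)" for z t
  proof -
    have c: "continuous_on (cbox T (T + h)) (\<Phi> (apply_bcontfun z))"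
      using lipschitz_on_continuous_on[OF \<Phi>lip[of "apply_bcontfun z"]] by simp
    have "(\<lambda>t. \<Phi> (apply_bcontfun z) (clamp T (T + h) t)) \<in> bcontfun"
      using clamp_continuous_on[OF c, of UNIV] clamp_bounded[OF compact_imp_bounded[OF compact_continuous_image[OF c compact_cbox]]]
      by (auto simp: bcontfun_def)
    then show ?thesis by (simp add: \<Psi>_def Bcontfun_inverse)
  qed
  \<comment> \<open>The integrands differ by at most \<open>L * dist z w\<close>, over a time of at
    most \<open>h\<close>.\<close>
  have contr: "dist (\<Psi> z) (\<Psi> w) \<le> h * L * dist z w" for z w
  proof (rule dist_bound)
    fix t
    define s where "s = clamp T (T + h) t"
    have s: "T \<le> s" "s \<le> T + h" using proj[of t] by (auto simp: s_def)
    have "dist (\<Psi> z t) (\<Psi> w t) = norm (integral {T..s} (\<lambda>r. F (z r) (d r) - F (w r) (d r)))"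
      unfolding \<Psi> \<Phi>_def s_def[symmetric] using s
      by (subst Henstock_Kurzweil_Integration.integral_diff) (auto intro!: int simp: dist_norm)
    also have "\<dots> \<le> (L * dist z w) * (s - T)"
    proof (rule norm_integral_le_real)
      fix r assume r: "r \<in> {T..s}"
      have "norm (F (z r) (d r) - F (w r) (d r)) \<le> L * norm (z r - w r)"
        using r T by (intro lipschitz_on_normD[OF lip] dD) auto
      also have "\<dots> \<le> L * dist z w"
        using dist_bounded[of z r w] L by (intro mult_left_mono) (auto simp: dist_norm)
      finally show "norm (F (z r) (d r) - F (w r) (d r)) \<le> L * dist z w" .
    qed (use s L in \<open>auto intro!: Henstock_Kurzweil_Integration.integrable_diff int\<close>)
    also have "\<dots> \<le> (L * dist z w) * h"
      using s L by (intro mult_left_mono) auto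
    finally show "dist (\<Psi> z t) (\<Psi> w t) \<le> h * L * dist z w" by (simp add: mult_ac)
  qed
  have "\<exists>!z. \<Psi> z = z"
    using contr h L by (intro banach_fix_type[of "h * L"]) auto
  then obtain z where z: "\<Psi> z = z" by blast
  have zt: "apply_bcontfun z t = \<Phi> z t" if "t \<in> ?I" for t
  proof -
    have "apply_bcontfun z t = apply_bcontfun (\<Psi> z) t" using z by simp
    also have "\<dots> = \<Phi> z t" using that by (simp add: \<Psi>)
    finally show ?thesis .
  qed
  have zc: "continuous_on UNIV (apply_bcontfun z)" by simp
  \<comment> \<open>Extended by zero, the integrand is integrable on every interval, as Lebesgue
    differentiation requires.\<close>
  define f where "f s = (if s \<in> ?I then F (z s) (d s) else 0)" for s
  have fint: "f integrable_on {a..b}" for a b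
  proof -
    have "f integrable_on UNIV"
      unfolding f_def integrable_restrict_UNIV by (rule int[OF zc]) auto
    then show ?thesis by (rule integrable_on_subinterval) auto
  qed
  obtain N where N: "negligible N"
    "\<And>t a. t \<notin> N \<Longrightarrow> a < t \<Longrightarrow> ((\<lambda>u. integral {a..u} f) has_vector_derivative f t) (at t)"
    using lebesgue_differentiation_real[of f] fint by metis
  show thesis
  proof (rule that[of "apply_bcontfun z" N])
    show "apply_bcontfun z T = x0" using zt[of T] h by (simp add: \<Phi>_def)
    show "B-lipschitz_on ?I (apply_bcontfun z)"
      by (rule lipschitz_on_transform[OF \<Phi>lip[OF zc]]) (use zt in auto)
    show "negligible N" by (fact N)
    fix t assume t: "t \<in> {T<..<T + h} - N"
    have "((\<lambda>u. x0 + integral {T..u} f) has_vector_derivative 0 + f t) (at t)"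
      using t by (intro has_vector_derivative_add has_vector_derivative_const N) auto
    then have "((\<lambda>u. x0 + integral {T..u} f) has_vector_derivative F (z t) (d t)) (at t)"
      using t by (simp add: f_def)
    then show "(apply_bcontfun z has_vector_derivative F (z t) (d t)) (at t)"
    proof (rule has_vector_derivative_transform_within_open[where S="{T<..<T + h}"])
      fix u assume u: "u \<in> {T<..<T + h}"
      have "integral {T..u} f = integral {T..u} (\<lambda>s. F (z s) (d s))"
        using u by (intro Henstock_Kurzweil_Integration.integral_cong) (auto simp: f_def)
      then show "x0 + integral {T..u} f = apply_bcontfun z u"
        using zt[of u] u by (simp add: \<Phi>_def)
    qed (use t in auto)
  qed
qed

lemma bounded_vector_field_on_compact:
  fixes F :: "'a::metric_space \<Rightarrow> 'd::metric_space \<Rightarrow> 'b::real_normed_vector"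
  assumes "continuous_on UNIV (\<lambda>(x, d). F x d)" "compact K" "compact D"
  obtains B where "B \<ge> 0" "\<And>x d. x \<in> K \<Longrightarrow> d \<in> D \<Longrightarrow> norm (F x d) \<le> B"
proof -
  have "compact ((\<lambda>(x, d). F x d) ` (K \<times> D))"
    by (intro compact_continuous_image compact_Times assms continuous_on_subset[OF assms(1)]) auto
  then obtain B where B: "B > 0" "\<And>y. y \<in> (\<lambda>(x, d). F x d) ` (K \<times> D) \<Longrightarrow> norm y \<le> B"
    using compact_imp_bounded bounded_pos by metis
  show thesis
  proof (rule that[of B])
    show "norm (F x d) \<le> B" if "x \<in> K" "d \<in> D" for x d
      using that by (intro B(2)) (auto intro: image_eqI[of _ _ "(x, d)"])
  qed (use B in auto)
qed

text \<open>Composition with the projection \<open>\<pi>\<close> onto a ball that contains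
  \<open>x0\<close> with distance 1 to spare gives a bounded, globally Lipschitz field;
  \<open>\<pi>\<close> is nonexpansive, so \<open>L\<close> survives. For a short time the solution
  cannot leave the ball, where both fields agree.\<close>

theorem caratheodory_local_existence:
  fixes F :: "'a::euclidean_space \<Rightarrow> 'd::euclidean_space \<Rightarrow> 'a"
  assumes cont: "continuous_on UNIV (\<lambda>(x, d). F x d)" and D: "compact D"
    and lip: "\<And>r. \<exists>L. \<forall>d\<in>D. L-lipschitz_on (cball 0 r) (\<lambda>x. F x d)"
    and d: "disturbance_signal D d" and T: "T \<ge> 0"
  obtains z N h B where "h > 0" "z T = x0" "B-lipschitz_on {T..T + h} z" "negligible N"
    "\<And>t. t \<in> {T<..<T + h} - N \<Longrightarrow> (z has_vector_derivative F (z t) (d t)) (at t)"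
proof -
  let ?K = "cball 0 (norm x0 + 1) :: 'a set"
  define \<pi> where "\<pi> = closest_point ?K"
  have K: "convex ?K" "closed ?K" "?K \<noteq> {}"
    using norm_ge_zero[of x0] by (auto simp: not_less simp del: norm_ge_zero)
  have \<pi>lip: "1-lipschitz_on UNIV \<pi>"
    unfolding \<pi>_def using closest_point_lipschitz[OF K] by (intro lipschitz_onI) auto
  have \<pi>K: "\<pi> x \<in> ?K" for x unfolding \<pi>_def by (rule closest_point_in_set) (use K in auto)
  obtain L where L: "\<And>d. d \<in> D \<Longrightarrow> L-lipschitz_on ?K (\<lambda>x. F x d)" using lip by blast
  obtain B where B: "B \<ge> 0" "\<And>x d. x \<in> ?K \<Longrightarrow> d \<in> D \<Longrightarrow> norm (F x d) \<le> B"
    using bounded_vector_field_on_compact[OF cont compact_cball D] by metis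
  have "d 0 \<in> D" using d by (simp add: disturbance_signal_def)
  then have L0: "L \<ge> 0" using L lipschitz_on_nonneg by blast
  have Fcont: "continuous_on UNIV (\<lambda>(x, d). F (\<pi> x) d)"
  proof -
    have "continuous_on UNIV (\<lambda>p. (\<pi> (fst p), snd p))"
      by (intro continuous_intros continuous_on_compose2[OF lipschitz_on_continuous_on[OF \<pi>lip]]) auto
    then show ?thesis
      using continuous_on_compose2[OF cont] by (fastforce simp: case_prod_beta)
  qed
  have Flip: "L-lipschitz_on UNIV (\<lambda>x. F (\<pi> x) d)" if "d \<in> D" for d
  proof -
    have "\<pi> ` UNIV \<subseteq> ?K" using \<pi>K by blast
    from lipschitz_on_compose2[OF \<pi>lip lipschitz_on_subset[OF L[OF that] this]] show ?thesis by simp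
  qed
  \<comment> \<open>Dividing by \<open>L + 1\<close> covers \<open>L = 0\<close> and makes the
    contraction factor \<open>L / (L + 1)\<close>.\<close>
  have hL: "1 / (L + 1) > 0" "1 / (L + 1) * L < 1" using L0 by (auto simp: field_simps)
  obtain z N where z: "z T = x0" "B-lipschitz_on {T..T + 1 / (L + 1)} z" "negligible N"
    "\<And>t. t \<in> {T<..<T + 1 / (L + 1)} - N \<Longrightarrow> (z has_vector_derivative F (\<pi> (z t)) (d t)) (at t)"
    using caratheodory_existence_globally_lipschitz[OF Fcont Flip B(2)[OF \<pi>K] d T hL] by metis
  \<comment> \<open>At speed at most \<open>B\<close>, the second bound limits the displacement to
    1.\<close>
  define h where "h = min (1 / (L + 1)) (1 / (B + 1))"
  have h: "h > 0" "h \<le> 1 / (L + 1)" "B * h \<le> 1"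
  proof -
    show "h > 0" "h \<le> 1 / (L + 1)" using L0 B(1) by (auto simp: h_def)
    have "B * h \<le> B * (1 / (B + 1))" using B(1) by (intro mult_left_mono) (auto simp: h_def)
    also have "\<dots> \<le> 1" using B(1) by (simp add: field_simps)
    finally show "B * h \<le> 1" .
  qed
  show thesis
  proof (rule that[of h z B N])
    show "B-lipschitz_on {T..T + h} z"
      by (rule lipschitz_on_subset[OF z(2)]) (use h in auto)
    fix t assume t: "t \<in> {T<..<T + h} - N"
    have "norm (z t - x0) \<le> B * (t - T)"
      using lipschitz_on_normD[OF z(2), of t T] t h z(1) L0 by auto
    also have "\<dots> \<le> B * h" using t B(1) by (intro mult_left_mono) auto
    finally have "norm (z t) \<le> norm x0 + 1"
      using h(3) norm_triangle_ineq2[of "z t" x0] by linarith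
    then have "\<pi> (z t) = z t" unfolding \<pi>_def by (intro closest_point_self) simp
    then show "(z has_vector_derivative F (z t) (d t)) (at t)"
      using z(4)[of t] t h by auto
  qed (use h z in auto)
qed

section \<open>Solutions in compact sets and invariance of polyhedra\<close>

lemma solution_onD:
  assumes "solution_on F d I x"
  shows "is_interval I" "0 \<in> I" "I \<subseteq> {0..}"
    "\<And>a b. {a..b} \<subseteq> I \<Longrightarrow> absolutely_continuous_on {a..b} x"
    "\<And>a b. a \<in> I \<Longrightarrow> b \<in> I \<Longrightarrow> {a..b} \<subseteq> I"
proof -
  show I: "is_interval I" "0 \<in> I" "I \<subseteq> {0..}"
    "\<And>a b. {a..b} \<subseteq> I \<Longrightarrow> absolutely_continuous_on {a..b} x"
    using assms by (auto simp: solution_on_def)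
  show "{a..b} \<subseteq> I" if "a \<in> I" "b \<in> I" for a b
    using I(1) that unfolding is_interval_1 by (meson atLeastAtMost_iff subsetI)
qed

text \<open>On \<open>P\<close> the speed is bounded uniformly over \<open>D\<close>; the increment
  estimate turns this almost-everywhere bound into one Lipschitz constant on all of
  \<open>I\<close>, however far \<open>I\<close> reaches.\<close>

lemma solution_on_in_compact_lipschitz:
  fixes F :: "'a::euclidean_space \<Rightarrow> 'd::euclidean_space \<Rightarrow> 'a"
  assumes cont: "continuous_on UNIV (\<lambda>(x, d). F x d)" and D: "compact D"
    and d: "disturbance_signal D d" and sol: "solution_on F d I x"
    and P: "compact P" "\<And>t. t \<in> I \<Longrightarrow> x t \<in> P"
  obtains B where "B-lipschitz_on I x"
proof -
  obtain B where B: "B \<ge> 0" "\<And>x d. x \<in> P \<Longrightarrow> d \<in> D \<Longrightarrow> norm (F x d) \<le> B"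
    using bounded_vector_field_on_compact[OF cont P(1) D] by metis
  obtain N where N: "negligible N"
    "\<And>t. t \<in> I - N \<Longrightarrow> (x has_vector_derivative F (x t) (d t)) (at t within I)"
    using sol unfolding solution_on_def by blast
  note I = solution_onD[OF sol]
  have "B-lipschitz_on I x"
  proof (rule lipschitz_on_leI)
    fix s t assume st: "s \<in> I" "t \<in> I" "s \<le> t"
    have sub: "{s..t} \<subseteq> I" using I(5) st by blast
    have "norm (x t - x s) \<le> B * (t - s)"
    proof (rule absolutely_continuous_on_norm_increment_le[OF st(3) I(4)[OF sub] N(1)])
      fix r assume r: "r \<in> {s..t} - N"
      then have "r \<in> I" using sub by blast
      then have "norm (F (x r) (d r)) \<le> B"
        using I(3) d P(2) by (intro B(2)) (auto simp: disturbance_signal_def)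
      moreover have "(x has_vector_derivative F (x r) (d r)) (at r within {s..t})"
        using N(2)[of r] r sub has_vector_derivative_within_subset by blast
      ultimately show "\<exists>x'. (x has_vector_derivative x') (at r within {s..t}) \<and> norm x' \<le> B"
        by blast
    qed
    then show "dist (x s) (x t) \<le> B * dist s t"
      using st by (simp add: dist_norm norm_minus_commute)
  qed (fact B)
  then show thesis by (rule that)
qed

text \<open>
  A solution staying in a compact set is Lipschitz, hence extends to the closure of its domain and
  from there by local existence.
\<close>

theorem maximal_solution_in_compact_global:
  fixes F :: "'a::euclidean_space \<Rightarrow> 'd::euclidean_space \<Rightarrow> 'a"
  assumes cont: "continuous_on UNIV (\<lambda>(x, d). F x d)" and D: "compact D"
    and lip: "\<And>r. \<exists>L. \<forall>d\<in>D. L-lipschitz_on (cball 0 r) (\<lambda>x. F x d)"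
    and d: "disturbance_signal D d" and max: "maximal_solution_on F d I x"
    and P: "compact P" "\<And>t. t \<in> I \<Longrightarrow> x t \<in> P"
  shows "I = {0..}"
proof (rule ccontr)
  assume ne: "I \<noteq> {0..}"
  have sol: "solution_on F d I x" using max by (simp add: maximal_solution_on_def)
  note I = solution_onD[OF sol]
  obtain N where N: "negligible N"
    "\<And>t. t \<in> I - N \<Longrightarrow> (x has_vector_derivative F (x t) (d t)) (at t within I)"
    using sol unfolding solution_on_def by blast
  obtain s where s: "s \<ge> 0" "s \<notin> I" using ne I(3) by auto
  \<comment> \<open>\<open>I\<close> is an interval containing 0, so the missing time
    \<open>s\<close> bounds it.\<close>
  have bdd: "t \<le> s" if "t \<in> I" for t
  proof (rule ccontr)
    assume "\<not> t \<le> s"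
    then have "s \<in> {0..t}" using s(1) by simp
    then show False using I(5)[OF I(2) that] s(2) by blast
  qed
  then have bI: "bdd_above I" by (meson bdd_above.I)
  define T where "T = Sup I"
  have T: "t \<le> T" if "t \<in> I" for t using that bI by (simp add: T_def cSup_upper)
  have T0: "T \<ge> 0" using T[OF I(2)] .
  have TI: "{0..<T} \<subseteq> I"
  proof
    fix t assume t: "t \<in> {0..<T}"
    then obtain u where "u \<in> I" "t < u" using less_cSup_iff[of I t] bI I(2) by (auto simp: T_def)
    then show "t \<in> I" using I(5)[OF I(2), of u] t by auto
  qed
  have cl: "{0..T} \<subseteq> closure I"
  proof -
    have "T \<in> closure I" unfolding T_def using bI I(2) by (intro closure_contains_Sup) auto
    moreover have "{0..<T} \<subseteq> closure I" using TI closure_subset by blast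
    ultimately show ?thesis by (auto simp: less_le)
  qed
  obtain B where "B-lipschitz_on I x"
    using solution_on_in_compact_lipschitz[OF cont D d sol P] by metis
  \<comment> \<open>\<open>y1\<close> supplies a value at \<open>T\<close> whether or not
    \<open>T\<close> belongs to \<open>I\<close>, so half-open and closed domains are treated
    alike.\<close>
  then obtain y1 where y1: "B-lipschitz_on (closure I) y1" "\<And>t. t \<in> I \<Longrightarrow> y1 t = x t"
    using lipschitz_extend_closure[of B I x] by blast
  obtain z M h C where z: "h > 0" "z T = y1 T" "C-lipschitz_on {T..T + h} z" "negligible M"
    "\<And>t. t \<in> {T<..<T + h} - M \<Longrightarrow> (z has_vector_derivative F (z t) (d t)) (at t)"
    using caratheodory_local_existence[OF cont D lip d T0] by metis
  define J where "J = {0..T + h}"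
  define y where "y t = (if t \<le> T then y1 t else z t)" for t
  have ylip: "(max B C)-lipschitz_on J y"
    unfolding J_def y_def[abs_def]
    by (rule lipschitz_on_concat_max[OF lipschitz_on_subset[OF y1(1) cl] z(3)]) (use z in auto)
  have yx: "y t = x t" if "t \<in> I" for t using T[OF that] y1(2)[OF that] by (simp add: y_def)
  \<comment> \<open>At \<open>0\<close>, \<open>T\<close> and \<open>T + h\<close> a two-sided
    derivative need not exist; these finitely many points join the exceptional set.\<close>
  have yder: "(y has_vector_derivative F (y t) (d t)) (at t)"
    if t: "t \<in> J - (N \<union> M \<union> {0, T, T + h})" for t
  proof (cases "t < T")
    case True
    then have t': "t \<in> {0<..<T}" using t by (auto simp: J_def)
    then have "t \<in> I" using TI by auto
    have "{0<..<T} \<subseteq> interior I"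
      using TI by (intro interior_maximal) auto
    then have "t \<in> interior I" using t' by blast
    moreover have "t \<in> I - N" using \<open>t \<in> I\<close> t by blast
    ultimately have "(x has_vector_derivative F (x t) (d t)) (at t)"
      using N(2) at_within_interior by metis
    then have "(y has_vector_derivative F (x t) (d t)) (at t)"
      by (rule has_vector_derivative_transform_within_open[where S="{0<..<T}"])
         (use t' TI in \<open>auto intro!: yx[symmetric]\<close>)
    then show ?thesis using yx[OF \<open>t \<in> I\<close>] by simp
  next
    case False
    then have t': "t \<in> {T<..<T + h}" using t by (auto simp: J_def)
    have "(z has_vector_derivative F (z t) (d t)) (at t)" by (rule z(5)) (use t t' in blast)
    then have "(y has_vector_derivative F (z t) (d t)) (at t)"
      by (rule has_vector_derivative_transform_within_open[where S="{T<..<T + h}"])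
         (use t' in \<open>auto simp: y_def\<close>)
    then show ?thesis using t' by (simp add: y_def)
  qed
  have "\<forall>t\<in>J - (N \<union> M \<union> {0, T, T + h}). (y has_vector_derivative F (y t) (d t)) (at t within J)"
    by (rule ballI, rule has_vector_derivative_at_within, rule yder)
  moreover have "negligible (N \<union> M \<union> {0, T, T + h})"
    using N z by (intro negligible_Un) auto
  moreover have "\<forall>a b. {a..b} \<subseteq> J \<longrightarrow> absolutely_continuous_on {a..b} y"
    by (intro allI impI lipschitz_on_imp_absolutely_continuous_on[OF lipschitz_on_subset[OF ylip]])
  ultimately have "solution_on F d J y"
    unfolding solution_on_def
  proof (intro conjI)
    show "is_interval J" "0 \<in> J" "J \<subseteq> {0..}" using T0 z(1) by (simp_all add: J_def is_interval_cc)
  qed blast+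
  moreover have "I \<subset> J"
  proof -
    have "T + h \<notin> I" using T[of "T + h"] z(1) by auto
    moreover have "I \<subseteq> J" using T I(3) z(1) by (force simp: J_def)
    moreover have "T + h \<in> J" using T0 z(1) by (simp add: J_def)
    ultimately show ?thesis by blast
  qed
  ultimately show False
    using max yx unfolding maximal_solution_on_def by (elim conjE notE) (intro exI conjI ballI)
qed

text \<open>The tube lemma. It spreads an open condition that holds at one state for all
  \<open>d \<in> D\<close> to a neighbourhood of states that does not depend on
  \<open>d\<close>.\<close>

lemma compact_fibre_neighbourhood:
  fixes W :: "('a::topological_space \<times> 'b::topological_space) set"
  assumes "open W" "compact D" "{x} \<times> D \<subseteq> W"
  obtains V where "open V" "x \<in> V" "V \<times> D \<subseteq> W"
  using tube_lemma_right[of euclidean euclidean W D x] assms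
  by (auto simp: euclidean_product_topology intro!: that)

text \<open>An induction over continuous time: at the last time \<open>T\<close> up to which the
  solution stays in \<open>P\<close> it is still in \<open>P\<close> by closedness, and afterwards
  each constraint persists for a while, either because it is slack or because its functional cannot
  grow. Finitely many constraints leave a common time span.\<close>

theorem polyhedron_invariant_if_strictly_inward:
  fixes F :: "'a::euclidean_space \<Rightarrow> 'd::euclidean_space \<Rightarrow> 'a" and \<gamma> :: "'k \<Rightarrow> 'a"
  assumes cont: "continuous_on UNIV (\<lambda>(x, d). F x d)" and D: "compact D"
    and d: "disturbance_signal D d" and sol: "solution_on F d I x"
    and K: "finite K" and P: "P = {x. \<forall>k\<in>K. \<gamma> k \<bullet> x \<le> \<eta> k}" and x0: "x 0 \<in> P"
    and inward: "\<And>x d k. x \<in> P \<Longrightarrow> d \<in> D \<Longrightarrow> k \<in> K \<Longrightarrow> \<gamma> k \<bullet> x = \<eta> k \<Longrightarrow> \<gamma> k \<bullet> F x d < 0"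
    and t1: "t1 \<in> I"
  shows "x t1 \<in> P"
proof (rule ccontr)
  assume out: "x t1 \<notin> P"
  note I = solution_onD[OF sol]
  have I01: "{0..t1} \<subseteq> I" using I(5)[OF I(2) t1] .
  have t10: "t1 \<ge> 0" using I(3) t1 by auto
  obtain N where N: "negligible N"
    "\<And>t. t \<in> I - N \<Longrightarrow> (x has_vector_derivative F (x t) (d t)) (at t within I)"
    using sol unfolding solution_on_def by blast
  have xc: "continuous_on {0..t1} x"
    by (rule absolutely_continuous_on_imp_continuous_on[OF I(4)[OF I01]])
  have near: "\<exists>e>0. \<forall>t\<in>{0..t1}. dist t s < e \<longrightarrow> x t \<in> V"
    if s: "s \<in> {0..t1}" and V: "open V" "x s \<in> V" for s V
  proof -
    obtain r where r: "r > 0" "ball (x s) r \<subseteq> V" using V openE by blast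
    obtain e where "e > 0" "\<forall>t\<in>{0..t1}. dist t s < e \<longrightarrow> dist (x t) (x s) < r"
      using xc[unfolded continuous_on_iff] s r(1) by blast
    then show ?thesis using r(2) by (metis dist_commute mem_ball subsetD)
  qed
  have face: "\<exists>e>0. \<forall>t\<in>{s..t1}. t < s + e \<longrightarrow> \<gamma> k \<bullet> x t \<le> \<eta> k"
    if s: "s \<in> {0..t1}" "x s \<in> P" and k: "k \<in> K" for s k
  proof (cases "\<gamma> k \<bullet> x s = \<eta> k")
    case False
    then have "x s \<in> {v. \<gamma> k \<bullet> v < \<eta> k}" using s k by (force simp: P)
    from near[OF s(1) open_halfspace_lt this] obtain e where e: "e > 0"
      "\<And>t. t \<in> {0..t1} \<Longrightarrow> dist t s < e \<Longrightarrow> \<gamma> k \<bullet> x t < \<eta> k" by auto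
    show ?thesis
    proof (intro exI conjI ballI impI)
      fix t assume "t \<in> {s..t1}" "t < s + e"
      then have "\<gamma> k \<bullet> x t < \<eta> k" using s by (intro e(2)) (auto simp: dist_real_def)
      then show "\<gamma> k \<bullet> x t \<le> \<eta> k" by simp
    qed (fact e)
  next
    case True
    \<comment> \<open>\<open>inward\<close> concerns states in \<open>P\<close>, but just after
      \<open>s\<close> the solution might lie outside. The strict sign is therefore spread to a full
      neighbourhood, uniformly over \<open>D\<close> because \<open>d\<close> may jump.\<close>
    let ?W = "{p. \<gamma> k \<bullet> (case p of (x, d) \<Rightarrow> F x d) < 0}"
    have "open ?W" by (intro open_Collect_less continuous_intros cont)
    moreover have "{x s} \<times> D \<subseteq> ?W" using inward[OF s(2) _ k True] by auto
    ultimately obtain V where V: "open V" "x s \<in> V" "V \<times> D \<subseteq> ?W"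
      using compact_fibre_neighbourhood[of ?W D "x s"] D by metis
    obtain e where e: "e > 0" "\<And>t. t \<in> {0..t1} \<Longrightarrow> dist t s < e \<Longrightarrow> x t \<in> V"
      using near[OF s(1) V(1,2)] by auto
    show ?thesis
    proof (intro exI conjI ballI impI)
      fix t assume t: "t \<in> {s..t1}" "t < s + e"
      have sub: "{s..t} \<subseteq> I" using t s I01 by auto
      have "\<gamma> k \<bullet> x t - \<gamma> k \<bullet> x s \<le> 0 * (t - s)"
      proof (rule absolutely_continuous_on_increment_le[OF _ _ N(1)])
        show "absolutely_continuous_on {s..t} (\<lambda>t. \<gamma> k \<bullet> x t)"
          by (rule absolutely_continuous_on_bounded_linear[OF I(4)[OF sub] bounded_linear_inner_right])
        fix r assume r: "r \<in> {s..t} - N"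
        have "x r \<in> V" using r t s by (intro e(2)) (auto simp: dist_real_def)
        moreover have "d r \<in> D" using d r s by (auto simp: disturbance_signal_def)
        ultimately have "\<gamma> k \<bullet> F (x r) (d r) < 0" using V(3) by auto
        moreover have "(x has_vector_derivative F (x r) (d r)) (at r within {s..t})"
          using N(2)[of r] r sub has_vector_derivative_within_subset by blast
        then have "((\<lambda>t. \<gamma> k \<bullet> x t) has_real_derivative \<gamma> k \<bullet> F (x r) (d r)) (at r within {s..t})"
          unfolding has_real_derivative_iff_has_vector_derivative
          by (rule bounded_linear.has_vector_derivative[OF bounded_linear_inner_right])
        ultimately show "\<exists>f'. ((\<lambda>t. \<gamma> k \<bullet> x t) has_real_derivative f') (at r within {s..t}) \<and> f' \<le> 0"
          by (meson less_imp_le)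
      qed (use t in auto)
      then show "\<gamma> k \<bullet> x t \<le> \<eta> k" using True by simp
    qed (fact e)
  qed
  have step: "\<exists>e>0. \<forall>t\<in>{s..t1}. t < s + e \<longrightarrow> x t \<in> P" if s: "s \<in> {0..t1}" "x s \<in> P" for s
  proof -
    obtain e where e: "\<And>k. k \<in> K \<Longrightarrow> e k > (0::real)"
      "\<And>k t. k \<in> K \<Longrightarrow> t \<in> {s..t1} \<Longrightarrow> t < s + e k \<Longrightarrow> \<gamma> k \<bullet> x t \<le> \<eta> k"
      using face[OF s] by metis
    \<comment> \<open>The inserted \<open>1\<close> keeps the minimum defined if \<open>K\<close> is
      empty.\<close>
    define m where "m = Min (insert 1 (e ` K))"
    have m: "m > 0" "\<And>k. k \<in> K \<Longrightarrow> m \<le> e k" using K e(1) by (auto simp: m_def)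
    show ?thesis
    proof (intro exI conjI ballI impI)
      fix t assume t: "t \<in> {s..t1}" "t < s + m"
      have "\<gamma> k \<bullet> x t \<le> \<eta> k" if "k \<in> K" for k
        using t m(2)[OF that] by (intro e(2)[OF that]) auto
      then show "x t \<in> P" by (simp add: P)
    qed (fact m)
  qed
  \<comment> \<open>Membership asks for the whole past \<open>{0..t}\<close>, so that every time
    before the supremum is safe.\<close>
  define S where "S = {t \<in> {0..t1}. \<forall>s\<in>{0..t}. x s \<in> P}"
  define T where "T = Sup S"
  have S0: "0 \<in> S" using x0 t10 by (simp add: S_def)
  have bS: "bdd_above S" by (rule bdd_aboveI[of _ t1]) (simp add: S_def)
  have T: "T \<in> {0..t1}"
    using S0 bS by (auto simp: T_def S_def intro!: cSup_upper cSup_least)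
  have below: "x s \<in> P" if s: "s \<in> {0..<T}" for s
  proof -
    obtain u where "u \<in> S" "s < u" using s less_cSup_iff[of S s] S0 bS by (auto simp: T_def)
    then show ?thesis using s by (auto simp: S_def)
  qed
  have "closed P"
  proof -
    have "P = (\<Inter>k\<in>K. {x. \<gamma> k \<bullet> x \<le> \<eta> k})" by (auto simp: P)
    then show ?thesis by (simp add: closed_INT closed_halfspace_le)
  qed
  then have cl: "closed {t \<in> {0..t1}. x t \<in> P}"
    using continuous_closed_preimage[OF xc closed_atLeastAtMost] by (simp add: vimage_def Int_def conj_commute)
  have xT: "x T \<in> P"
  proof (cases "T = 0")
    case False
    then have "closure {0..<T} = {0..T}" using T by (intro closure_atLeastLessThan) auto
    moreover have "closure {0..<T} \<subseteq> {t \<in> {0..t1}. x t \<in> P}"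
      using below T by (intro closure_minimal cl) auto
    ultimately show ?thesis using T by auto
  qed (use x0 in simp)
  obtain e where e: "e > 0" "\<And>t. t \<in> {T..t1} \<Longrightarrow> t < T + e \<Longrightarrow> x t \<in> P"
    using step[OF T xT] by blast
  have "T \<noteq> t1" using xT out by auto
  define u where "u = min t1 (T + e / 2)"
  have u: "u > T" "u \<in> {T..t1}" "u < T + e" using \<open>T \<noteq> t1\<close> T e(1) by (auto simp: u_def)
  have "x s \<in> P" if "s \<in> {0..u}" for s
    using below[of s] e(2)[of s] that u by (cases "s < T") auto
  then have "u \<in> S" using u T by (auto simp: S_def)
  then have "u \<le> T" unfolding T_def using bS by (intro cSup_upper)
  then show False using u by simp
qed

section \<open>Multi-affine functions and blossoms\<close>

definition affine_fun :: "(real \<Rightarrow> real) \<Rightarrow> bool" where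
  "affine_fun \<phi> \<longleftrightarrow> (\<exists>a b. \<forall>r. \<phi> r = a + b * r)"

lemma affine_fun_const: "affine_fun (\<lambda>r. c)"
  unfolding affine_fun_def by (rule exI[of _ c], rule exI[of _ 0]) simp

lemma affine_fun_ident: "affine_fun (\<lambda>r. r)"
  unfolding affine_fun_def by (rule exI[of _ 0], rule exI[of _ 1]) simp

lemma affine_fun_add:
  assumes "affine_fun \<phi>" "affine_fun \<psi>"
  shows "affine_fun (\<lambda>r. \<phi> r + \<psi> r)"
proof -
  obtain a b a' b' where "\<And>r. \<phi> r = a + b * r" "\<And>r. \<psi> r = a' + b' * r"
    using assms unfolding affine_fun_def by blast
  then have "\<forall>r. \<phi> r + \<psi> r = (a + a') + (b + b') * r" by (simp add: algebra_simps)
  then show ?thesis unfolding affine_fun_def by blast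
qed

lemma affine_fun_cmult:
  assumes "affine_fun \<phi>"
  shows "affine_fun (\<lambda>r. c * \<phi> r)"
proof -
  obtain a b where "\<And>r. \<phi> r = a + b * r" using assms unfolding affine_fun_def by blast
  then have "\<forall>r. c * \<phi> r = (c * a) + (c * b) * r" by (simp add: algebra_simps)
  then show ?thesis unfolding affine_fun_def by blast
qed

lemma affine_fun_sum:
  assumes "\<And>k. k \<in> A \<Longrightarrow> affine_fun (\<phi> k)"
  shows "affine_fun (\<lambda>r. \<Sum>k\<in>A. \<phi> k r)"
  using assms by (induction A rule: infinite_finite_induct) (auto intro: affine_fun_const affine_fun_add)

text \<open>Affine functions are not closed under products; here only the factor \<open>j\<close>
  varies with \<open>r\<close>.\<close>

lemma affine_fun_prod_single:
  assumes "finite A" "affine_fun (\<phi> j)" "\<And>k r. k \<in> A \<Longrightarrow> k \<noteq> j \<Longrightarrow> \<phi> k r = c k"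
  shows "affine_fun (\<lambda>r. \<Prod>k\<in>A. \<phi> k r)"
proof (cases "j \<in> A")
  case True
  have "(\<Prod>k\<in>A. \<phi> k r) = (\<Prod>k\<in>A - {j}. c k) * \<phi> j r" for r
    using assms(3) by (simp add: prod.remove[OF assms(1) True])
  then show ?thesis by (simp add: affine_fun_cmult assms(2))
next
  case False
  have "(\<Prod>k\<in>A. \<phi> k r) = (\<Prod>k\<in>A. c k)" for r
    using False assms(3) by (intro prod.cong) auto
  then show ?thesis by (simp add: affine_fun_const)
qed

lemma affine_fun_ge_between:
  assumes "affine_fun \<phi>" "a \<le> r" "r \<le> b" "t \<le> \<phi> a" "t \<le> \<phi> b"
  shows "t \<le> \<phi> r"
proof -
  obtain u w where \<phi>: "\<And>r. \<phi> r = u + w * r" using assms(1) unfolding affine_fun_def by blast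
  show ?thesis
  proof (cases "w \<ge> 0")
    case True
    then have "w * a \<le> w * r" using assms(2) by (rule mult_left_mono[rotated])
    then show ?thesis using assms(4) by (simp add: \<phi>)
  next
    case False
    then have "w * b \<le> w * r" using assms(3) by (intro mult_left_mono_neg) auto
    then show ?thesis using assms(5) by (simp add: \<phi>)
  qed
qed

text \<open>Affinity is asked at every position \<open>s\<close>, also outside the blocks, so that
  the notion does not refer to the degrees.\<close>

definition multi_affine :: "(('r \<Rightarrow> nat \<Rightarrow> real) \<Rightarrow> real) \<Rightarrow> bool" where
  "multi_affine \<Phi> \<longleftrightarrow> (\<forall>z i s. affine_fun (\<lambda>r. \<Phi> (z(i := (z i)(s := r)))))"

lemma multi_affine_const: "multi_affine (\<lambda>z. c)"
  by (simp add: multi_affine_def affine_fun_const)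

lemma multi_affine_add: "multi_affine \<Phi> \<Longrightarrow> multi_affine \<Psi> \<Longrightarrow> multi_affine (\<lambda>z. \<Phi> z + \<Psi> z)"
  by (simp add: multi_affine_def affine_fun_add)

lemma multi_affine_cmult: "multi_affine \<Phi> \<Longrightarrow> multi_affine (\<lambda>z. c * \<Phi> z)"
  by (simp add: multi_affine_def affine_fun_cmult)

lemma multi_affine_sum:
  "(\<And>k. k \<in> A \<Longrightarrow> multi_affine (\<Phi> k)) \<Longrightarrow> multi_affine (\<lambda>z. \<Sum>k\<in>A. \<Phi> k z)"
  by (simp add: multi_affine_def affine_fun_sum)

lemma multi_affine_mult_const: "multi_affine \<Phi> \<Longrightarrow> multi_affine (\<lambda>z. \<Phi> z * c)"
  using multi_affine_cmult[of \<Phi> c] by (simp add: mult.commute)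

lemma multi_affine_minus: "multi_affine \<Phi> \<Longrightarrow> multi_affine (\<lambda>z. - \<Phi> z)"
  using multi_affine_cmult[of \<Phi> "- 1"] by simp

lemma multi_affine_diff: "multi_affine \<Phi> \<Longrightarrow> multi_affine \<Psi> \<Longrightarrow> multi_affine (\<lambda>z. \<Phi> z - \<Psi> z)"
  using multi_affine_add[of \<Phi> "\<lambda>z. - \<Psi> z"] multi_affine_minus[of \<Psi>] by simp

lemma multi_affine_coord: "multi_affine (\<lambda>z. z i s)"
proof -
  have "affine_fun (\<lambda>r. (z(j := (z j)(u := r))) i s)" for z :: "'a \<Rightarrow> nat \<Rightarrow> real" and j u
    by (cases "i = j"; cases "s = u") (auto simp: affine_fun_const affine_fun_ident)
  then show ?thesis by (simp add: multi_affine_def)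
qed

lemmas multi_affine_intros = multi_affine_const multi_affine_add multi_affine_diff multi_affine_minus
  multi_affine_cmult multi_affine_mult_const multi_affine_sum multi_affine_coord

text \<open>A subset contains \<open>s\<close> at most once, so the varied coordinate never occurs
  squared.\<close>

lemma affine_fun_blossom_basis: "affine_fun (\<lambda>r. blossom_basis e \<epsilon> (w(s := r)))"
  unfolding blossom_basis_def
proof (intro affine_fun_cmult affine_fun_sum)
  fix \<sigma> assume "\<sigma> \<in> {\<sigma>. \<sigma> \<subseteq> {1..\<epsilon>} \<and> card \<sigma> = e}"
  then have "finite \<sigma>" using finite_subset by auto
  then show "affine_fun (\<lambda>r. \<Prod>t\<in>\<sigma>. (w(s := r)) t)"
    by (intro affine_fun_prod_single[where j=s and c=w]) (auto simp: affine_fun_ident)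
qed

text \<open>A coordinate of block \<open>i\<close> enters each monomial only through the factor of
  block \<open>i\<close>.\<close>

lemma multi_affine_blossom: "multi_affine (blossom \<epsilon> p)"
  unfolding multi_affine_def blossom_def
proof (intro allI affine_fun_sum affine_fun_cmult)
  fix z :: "'a \<Rightarrow> nat \<Rightarrow> real" and i s e
  show "affine_fun (\<lambda>r. \<Prod>j\<in>UNIV. blossom_basis (Poly_Mapping.lookup e j) (\<epsilon> j) ((z(i := (z i)(s := r))) j))"
    by (rule affine_fun_prod_single[where j=i and
          c="\<lambda>j. blossom_basis (Poly_Mapping.lookup e j) (\<epsilon> j) (z j)"])
       (simp_all add: affine_fun_blossom_basis)
qed

text \<open>Coordinates in \<open>C\<close> are moved to the end points of their intervals one at a time.\<close>

lemma multi_affine_ge_if_ge_at_vertices: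
  assumes "finite C" "multi_affine \<Phi>"
    and "\<And>i s. (i, s) \<in> C \<Longrightarrow> lo i \<le> z i s \<and> z i s \<le> hi i"
    and "\<And>v. (\<And>i s. (i, s) \<in> C \<Longrightarrow> v i s \<in> {lo i, hi i}) \<Longrightarrow> (\<And>i s. (i, s) \<notin> C \<Longrightarrow> v i s = z i s) \<Longrightarrow> t \<le> \<Phi> v"
  shows "t \<le> \<Phi> z"
  using assms(1,3,4)
proof (induction C arbitrary: z rule: finite_induct)
  case empty
  then show ?case by simp
next
  case (insert c C)
  obtain i s where c: "c = (i, s)" by fastforce
  define w where "w r = z(i := (z i)(s := r))" for r
  have aff: "affine_fun (\<lambda>r. \<Phi> (w r))"
    using assms(2) by (simp add: multi_affine_def w_def)
  \<comment> \<open>\<open>w r\<close> differs from \<open>z\<close> at most in position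
    \<open>c\<close>, which is not in \<open>C\<close>. A vertex \<open>v\<close> for
    \<open>w r\<close> thus has the end point \<open>r\<close> there, so it is a vertex for
    \<open>insert c C\<close>.\<close>
  have w: "t \<le> \<Phi> (w r)" if r: "r \<in> {lo i, hi i}" for r
  proof (rule insert.IH)
    show "lo j \<le> w r j u \<and> w r j u \<le> hi j" if "(j, u) \<in> C" for j u
      using that insert.hyps(2) insert.prems(1)[of j u] by (auto simp: w_def c)
    fix v assume v: "\<And>j u. (j, u) \<in> C \<Longrightarrow> v j u \<in> {lo j, hi j}" "\<And>j u. (j, u) \<notin> C \<Longrightarrow> v j u = w r j u"
    show "t \<le> \<Phi> v"
    proof (rule insert.prems(2))
      show "v j u \<in> {lo j, hi j}" if "(j, u) \<in> insert c C" for j u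
        using that v(1)[of j u] v(2)[of j u] r by (cases "(j, u) \<in> C") (auto simp: w_def c)
      show "v j u = z j u" if "(j, u) \<notin> insert c C" for j u
        using that v(2)[of j u] by (auto simp: w_def c)
    qed
  qed
  have "lo i \<le> z i s" "z i s \<le> hi i"
    using insert.prems(1)[of i s] by (simp_all add: c)
  then have "t \<le> \<Phi> (w (z i s))"
    using affine_fun_ge_between[OF aff _ _ w w] by blast
  then show ?case by (simp add: w_def)
qed

section \<open>Invariance under permutations within blocks\<close>

lemma blossom_basis_permute:
  assumes \<pi>: "\<pi> permutes {1..\<epsilon>}" and w: "\<And>s. s \<in> {1..\<epsilon>} \<Longrightarrow> w' s = w (\<pi> s)"
  shows "blossom_basis e \<epsilon> w' = blossom_basis e \<epsilon> w"
proof -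
  have inj: "inj \<pi>" and inj': "inj (inv \<pi>)"
    using permutes_inj[OF \<pi>] permutes_inj[OF permutes_inv[OF \<pi>]] .
  \<comment> \<open>A permutation of the positions also permutes the \<open>e\<close>-element
    subsets, which reindexes the sum.\<close>
  have "(\<Sum>\<sigma> | \<sigma> \<subseteq> {1..\<epsilon>} \<and> card \<sigma> = e. \<Prod>s\<in>\<sigma>. w' s) = (\<Sum>\<sigma> | \<sigma> \<subseteq> {1..\<epsilon>} \<and> card \<sigma> = e. \<Prod>s\<in>\<sigma>. w s)"
  proof (rule sum.reindex_bij_witness[where i="image (inv \<pi>)" and j="image \<pi>"])
    fix \<sigma> assume \<sigma>: "\<sigma> \<in> {\<sigma>. \<sigma> \<subseteq> {1..\<epsilon>} \<and> card \<sigma> = e}"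
    show "inv \<pi> ` \<pi> ` \<sigma> = \<sigma>" "\<pi> ` inv \<pi> ` \<sigma> = \<sigma>"
      using permutes_inv_o[OF \<pi>] by (simp_all add: image_comp)
    show "\<pi> ` \<sigma> \<in> {\<sigma>. \<sigma> \<subseteq> {1..\<epsilon>} \<and> card \<sigma> = e}"
      using \<sigma> permutes_image[OF \<pi>] card_image[OF inj_on_subset[OF inj, of \<sigma>]] by auto
    show "inv \<pi> ` \<sigma> \<in> {\<sigma>. \<sigma> \<subseteq> {1..\<epsilon>} \<and> card \<sigma> = e}"
      using \<sigma> permutes_image[OF permutes_inv[OF \<pi>]] card_image[OF inj_on_subset[OF inj', of \<sigma>]] by auto
    have "(\<Prod>s\<in>\<pi> ` \<sigma>. w s) = (\<Prod>s\<in>\<sigma>. w (\<pi> s))"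
      using prod.reindex[OF inj_on_subset[OF inj, of \<sigma>], of w] by simp
    also have "\<dots> = (\<Prod>s\<in>\<sigma>. w' s)"
      using \<sigma> w by (intro prod.cong) auto
    finally show "(\<Prod>s\<in>\<pi> ` \<sigma>. w s) = (\<Prod>s\<in>\<sigma>. w' s)" .
  qed
  then show ?thesis by (simp add: blossom_basis_def)
qed

lemma blossom_block_perm:
  assumes "block_perm \<epsilon> z z'"
  shows "blossom \<epsilon> p z' = blossom \<epsilon> p z"
proof -
  have "blossom_basis e (\<epsilon> i) (z' i) = blossom_basis e (\<epsilon> i) (z i)" for e i
    using assms blossom_basis_permute unfolding block_perm_def by metis
  then show ?thesis by (simp add: blossom_def)
qed

text \<open>\<open>lift_vec\<close> has equal weights within a block, so only the sum of the block
  matters.\<close>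

lemma lifted_inner_block_perm:
  assumes "block_perm \<epsilon> z z'"
  shows "lifted_inner \<epsilon> (lift_vec \<epsilon> v) z' = lifted_inner \<epsilon> (lift_vec \<epsilon> v) z"
proof -
  have "(\<Sum>s=1..\<epsilon> i. v $ i / real (\<epsilon> i) * z' i s) = (\<Sum>s=1..\<epsilon> i. v $ i / real (\<epsilon> i) * z i s)" for i
  proof -
    obtain \<pi> where \<pi>: "\<pi> permutes {1..\<epsilon> i}" "\<And>s. s \<in> {1..\<epsilon> i} \<Longrightarrow> z' i s = z i (\<pi> s)"
      using assms unfolding block_perm_def by blast
    have "(\<Sum>s=1..\<epsilon> i. v $ i / real (\<epsilon> i) * z' i s) = (\<Sum>s=1..\<epsilon> i. v $ i / real (\<epsilon> i) * z i (\<pi> s))"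
      using \<pi>(2) by (intro sum.cong) auto
    also have "\<dots> = (\<Sum>s=1..\<epsilon> i. v $ i / real (\<epsilon> i) * z i s)"
      by (rule sum.reindex_bij_betw[OF permutes_imp_bij[OF \<pi>(1)]])
    finally show ?thesis .
  qed
  then show ?thesis by (simp add: lifted_inner_def lift_vec_def)
qed

text \<open>Moving coordinates to end points leaves values outside the blocks arbitrary, whereas
  members of \<open>lifted_vertices\<close> are extensional. Restricting \<open>v\<close> gives a
  genuine vertex; \<open>block_perm\<close> sees only positions inside the blocks, so the
  representative of its class is also a permutation of \<open>v\<close>.\<close>

lemma vertex_classes_rep:
  assumes v: "\<And>i s. s \<in> {1..\<epsilon> i} \<Longrightarrow> v i s \<in> {lo $ i, hi $ i}"
  obtains c where "c \<in> vertex_classes \<epsilon> lo hi" "block_perm \<epsilon> v (rep c)"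
proof -
  define w where "w = (\<lambda>i. restrict (v i) {1..\<epsilon> i})"
  have w: "w \<in> lifted_vertices \<epsilon> lo hi"
    using v by (auto simp: lifted_vertices_def w_def PiE_def Pi_def)
  define R where "R = {(z, z'). z \<in> lifted_vertices \<epsilon> lo hi \<and> z' \<in> lifted_vertices \<epsilon> lo hi \<and> block_perm \<epsilon> z z'}"
  have "block_perm \<epsilon> w w"
    unfolding block_perm_def by (auto intro!: exI[of _ id] permutes_id)
  then have "w \<in> R `` {w}" using w by (simp add: R_def)
  then have "rep (R `` {w}) \<in> R `` {w}"
    unfolding rep_def by (rule someI[of "\<lambda>z. z \<in> R `` {w}"])
  then have wr: "block_perm \<epsilon> w (rep (R `` {w}))" by (subst (asm) (2) R_def) blast
  have "block_perm \<epsilon> v (rep (R `` {w}))"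
    unfolding block_perm_def
  proof
    fix i
    obtain \<pi> where \<pi>: "\<pi> permutes {1..\<epsilon> i}" "\<And>s. s \<in> {1..\<epsilon> i} \<Longrightarrow> rep (R `` {w}) i s = w i (\<pi> s)"
      using wr unfolding block_perm_def by blast
    have "rep (R `` {w}) i s = v i (\<pi> s)" if "s \<in> {1..\<epsilon> i}" for s
    proof -
      have "\<pi> s \<in> {1..\<epsilon> i}" using permutes_in_image[OF \<pi>(1)] that by blast
      then show ?thesis using \<pi>(2)[OF that] by (simp add: w_def)
    qed
    then show "\<exists>\<pi>. \<pi> permutes {1..\<epsilon> i} \<and> (\<forall>s\<in>{1..\<epsilon> i}. rep (R `` {w}) i s = v i (\<pi> s))"
      using \<pi>(1) by blast
  qed
  moreover have "R `` {w} \<in> vertex_classes \<epsilon> lo hi"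
    unfolding vertex_classes_def R_def[symmetric] using w by (rule quotientI)
  ultimately show thesis using that by blast
qed

section \<open>Blossoms and lifted vectors on the diagonal\<close>

lemma blossom_basis_diagonal:
  assumes "e \<le> \<epsilon>"
  shows "blossom_basis e \<epsilon> (\<lambda>s. y) = y ^ e"
proof -
  \<comment> \<open>The sum has \<open>\<epsilon> choose e\<close> equal terms, which the
    normalising factor cancels; \<open>e \<le> \<epsilon>\<close> keeps that factor from
    degenerating to the inverse of 0.\<close>
  have "(\<Sum>\<sigma> | \<sigma> \<subseteq> {1..\<epsilon>} \<and> card \<sigma> = e. \<Prod>s\<in>\<sigma>. y) = (\<Sum>\<sigma> | \<sigma> \<subseteq> {1..\<epsilon>} \<and> card \<sigma> = e. y ^ e)"
    by (intro sum.cong) auto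
  also have "\<dots> = real (\<epsilon> choose e) * y ^ e"
    by (simp add: n_subsets)
  finally have "blossom_basis e \<epsilon> (\<lambda>s. y) = inverse (real (\<epsilon> choose e)) * (real (\<epsilon> choose e) * y ^ e)"
    by (simp only: blossom_basis_def)
  moreover have "real (\<epsilon> choose e) \<noteq> 0" using assms by simp
  ultimately show ?thesis by simp
qed

lemma blossom_diagonal:
  assumes "degrees_le \<epsilon> p"
  shows "blossom \<epsilon> p (\<lambda>i s. y i) = poly_eval p y"
  unfolding blossom_def poly_eval_def using assms
  by (intro sum.cong refl arg_cong2[where f="(*)"] prod.cong blossom_basis_diagonal)
     (auto simp: degrees_le_def)

text \<open>The weight \<open>v $ i / real (\<epsilon> i)\<close> occurs \<open>\<epsilon> i\<close>
  times; \<open>1 \<le> \<epsilon> i\<close> excludes an empty block, which would lose the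
  term.\<close>

lemma lifted_inner_diagonal:
  assumes "\<And>i. 1 \<le> \<epsilon> i"
  shows "lifted_inner \<epsilon> (lift_vec \<epsilon> v) (\<lambda>i s. y $ i) = v \<bullet> y"
proof -
  have "real (\<epsilon> i) \<noteq> 0" for i using assms[of i] by linarith
  then show ?thesis by (simp add: lifted_inner_def lift_vec_def inner_vec_def)
qed

section \<open>Joining the state and disturbance blocks\<close>

lemma multi_affine_comp_Inl:
  assumes "multi_affine \<Phi>"
  shows "multi_affine (\<lambda>z. \<Phi> (z \<circ> Inl))"
proof -
  \<comment> \<open>Varying one coordinate of \<open>z\<close> varies one coordinate of
    \<open>z \<circ> Inl\<close> or none.\<close>
  have "affine_fun (\<lambda>r. \<Phi> (z(i := (z i)(s := r)) \<circ> Inl))" for z :: "'a + 'b \<Rightarrow> nat \<Rightarrow> real" and i s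
  proof (cases i)
    case (Inl j)
    then have "z(i := (z i)(s := r)) \<circ> Inl = (z \<circ> Inl)(j := ((z \<circ> Inl) j)(s := r))" for r
      by (auto simp: fun_eq_iff)
    then show ?thesis using assms by (simp only: multi_affine_def)
  next
    case (Inr j)
    then have "z(i := (z i)(s := r)) \<circ> Inl = z \<circ> Inl" for r
      by (auto simp: fun_eq_iff)
    then show ?thesis by (simp only: affine_fun_const)
  qed
  then show ?thesis by (simp add: multi_affine_def)
qed

lemma multi_affine_comp_Inr:
  assumes "multi_affine \<Phi>"
  shows "multi_affine (\<lambda>z. \<Phi> (z \<circ> Inr))"
proof -
  have "affine_fun (\<lambda>r. \<Phi> (z(i := (z i)(s := r)) \<circ> Inr))" for z :: "'b + 'a \<Rightarrow> nat \<Rightarrow> real" and i s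
  proof (cases i)
    case (Inr j)
    then have "z(i := (z i)(s := r)) \<circ> Inr = (z \<circ> Inr)(j := ((z \<circ> Inr) j)(s := r))" for r
      by (auto simp: fun_eq_iff)
    then show ?thesis using assms by (simp only: multi_affine_def)
  next
    case (Inl j)
    then have "z(i := (z i)(s := r)) \<circ> Inr = z \<circ> Inr" for r
      by (auto simp: fun_eq_iff)
    then show ?thesis by (simp only: affine_fun_const)
  qed
  then show ?thesis by (simp add: multi_affine_def)
qed

lemma multi_affine_lifted_inner: "multi_affine (lifted_inner \<epsilon> w)"
  unfolding lifted_inner_def by (intro multi_affine_intros)

lemma block_perm_case_sum:
  assumes "block_perm \<delta> (z \<circ> Inl) x" "block_perm \<rho> (z \<circ> Inr) y"
  shows "block_perm (case_sum \<delta> \<rho>) z (case_sum x y)"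
  unfolding block_perm_def
proof
  fix i
  show "\<exists>\<pi>. \<pi> permutes {1..case_sum \<delta> \<rho> i} \<and>
      (\<forall>s\<in>{1..case_sum \<delta> \<rho> i}. case_sum x y i s = z i (\<pi> s))"
    using assms unfolding block_perm_def by (cases i) auto
qed

text \<open>Opens the matrix-vector product into finite sums, to which
  \<open>multi_affine_intros\<close> applies.\<close>

lemma inner_add_matrix_vector:
  fixes A :: "real ^ 'q ^ 'n"
  shows "v \<bullet> (u + A *v \<theta>) = (\<Sum>i\<in>UNIV. v $ i * (u $ i + (\<Sum>j\<in>UNIV. A $ i $ j * \<theta> $ j)))"
  by (simp add: inner_vec_def matrix_vector_mult_def)

lemma inner_matrix_vector:
  fixes A :: "real ^ 'q ^ 'n"
  shows "v \<bullet> (A *v \<theta>) = (\<Sum>i\<in>UNIV. v $ i * (\<Sum>j\<in>UNIV. A $ i $ j * \<theta> $ j))"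
  by (simp add: inner_vec_def matrix_vector_mult_def)

lemma finite_lifted_positions:
  fixes \<epsilon> :: "'r::finite \<Rightarrow> nat"
  shows "finite {(i, s). s \<in> {1..\<epsilon> i}}"
proof -
  have "{(i, s). s \<in> {1..\<epsilon> i}} = (SIGMA i:UNIV. {1..\<epsilon> i})" by auto
  then show ?thesis by simp
qed

text \<open>The bound is available at class representatives only; each vertex is exchanged for the
  representative of its class, which leaves \<open>\<Phi>\<close> unchanged.\<close>

lemma multi_affine_ge_diagonal:
  fixes \<Phi> :: "('r::finite \<Rightarrow> nat \<Rightarrow> real) \<Rightarrow> real"
  assumes "multi_affine \<Phi>" "\<And>z z'. block_perm \<epsilon> z z' \<Longrightarrow> \<Phi> z' = \<Phi> z"
    and "\<And>c. c \<in> vertex_classes \<epsilon> lo hi \<Longrightarrow> t \<le> \<Phi> (rep c)" and "x \<in> cbox lo hi"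
  shows "t \<le> \<Phi> (\<lambda>i s. x $ i)"
proof (rule multi_affine_ge_if_ge_at_vertices[OF finite_lifted_positions[of \<epsilon>] assms(1)])
  show "lo $ i \<le> x $ i \<and> x $ i \<le> hi $ i" for i using assms(4) by (simp add: mem_box_cart)
  fix v assume "\<And>i s. (i, s) \<in> {(i, s). s \<in> {1..\<epsilon> i}} \<Longrightarrow> v i s \<in> {lo $ i, hi $ i}"
  then obtain c where "c \<in> vertex_classes \<epsilon> lo hi" "block_perm \<epsilon> v (rep c)"
    using vertex_classes_rep[of \<epsilon> v lo hi] by auto
  then show "t \<le> \<Phi> v" using assms(2,3) by metis
qed

text \<open>Classes are formed separately for states and disturbances, so a vertex of the joint box
  is split along \<open>Inl\<close> and \<open>Inr\<close> and its halves are exchanged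
  independently.\<close>

lemma multi_affine_ge_diagonal_sum:
  fixes \<Phi> :: "('n::finite + 'm::finite \<Rightarrow> nat \<Rightarrow> real) \<Rightarrow> real"
  assumes "multi_affine \<Phi>" "\<And>z z'. block_perm (case_sum \<delta> \<rho>) z z' \<Longrightarrow> \<Phi> z' = \<Phi> z"
    and "\<And>c e. c \<in> vertex_classes \<delta> xlo xhi \<Longrightarrow> e \<in> vertex_classes \<rho> dlo dhi \<Longrightarrow> t \<le> \<Phi> (case_sum (rep c) (rep e))"
    and "x \<in> cbox xlo xhi" "d \<in> cbox dlo dhi"
  shows "t \<le> \<Phi> (\<lambda>i s. join x d i)"
proof (rule multi_affine_ge_if_ge_at_vertices[OF finite_lifted_positions[of "case_sum \<delta> \<rho>"] assms(1)])
  show "join xlo dlo i \<le> join x d i \<and> join x d i \<le> join xhi dhi i" for i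
    using assms(4,5) by (cases i) (simp_all add: mem_box_cart join_def)
  fix v assume v: "\<And>i s. (i, s) \<in> {(i, s). s \<in> {1..case_sum \<delta> \<rho> i}} \<Longrightarrow>
      v i s \<in> {join xlo dlo i, join xhi dhi i}"
  have l: "(v \<circ> Inl) i s \<in> {xlo $ i, xhi $ i}" if "s \<in> {1..\<delta> i}" for i s
    using v[of "Inl i" s] that by (simp add: join_def)
  have r: "(v \<circ> Inr) i s \<in> {dlo $ i, dhi $ i}" if "s \<in> {1..\<rho> i}" for i s
    using v[of "Inr i" s] that by (simp add: join_def)
  obtain c where c: "c \<in> vertex_classes \<delta> xlo xhi" "block_perm \<delta> (v \<circ> Inl) (rep c)"
    using vertex_classes_rep[of \<delta> "v \<circ> Inl" xlo xhi, OF l] by blast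
  obtain e where e: "e \<in> vertex_classes \<rho> dlo dhi" "block_perm \<rho> (v \<circ> Inr) (rep e)"
    using vertex_classes_rep[of \<rho> "v \<circ> Inr" dlo dhi, OF r] by blast
  have "\<Phi> (case_sum (rep c) (rep e)) = \<Phi> v"
    by (rule assms(2)[OF block_perm_case_sum[OF c(2) e(2)]])
  then show "t \<le> \<Phi> v" using assms(3)[OF c(1) e(1)] by simp
qed

section \<open>Functions that are Lipschitz on compact sets\<close>

text \<open>Unlike global Lipschitz continuity, this is stable under products and so covers
  polynomials. On pairs \<open>(x, d)\<close> it yields both continuity of the field and a Lipschitz
  constant in \<open>x\<close> common to all \<open>d\<close> in a compact set.\<close>

definition lipschitz_on_compacts :: "('a::metric_space \<Rightarrow> 'b::metric_space) \<Rightarrow> bool" where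
  "lipschitz_on_compacts \<phi> \<longleftrightarrow> (\<forall>S. compact S \<longrightarrow> (\<exists>L. L-lipschitz_on S \<phi>))"

lemma lipschitz_on_compactsI:
  "(\<And>S. compact S \<Longrightarrow> \<exists>L. L-lipschitz_on S \<phi>) \<Longrightarrow> lipschitz_on_compacts \<phi>"
  by (simp add: lipschitz_on_compacts_def)

lemma lipschitz_on_compactsE:
  assumes "lipschitz_on_compacts \<phi>" "compact S"
  obtains L where "L-lipschitz_on S \<phi>"
  using assms unfolding lipschitz_on_compacts_def by metis

lemma lipschitz_on_compacts_const: "lipschitz_on_compacts (\<lambda>x. c)"
  by (rule lipschitz_on_compactsI, rule exI, rule lipschitz_on_constant)

lemma lipschitz_on_compacts_add:
  fixes \<phi> \<psi> :: "'a::metric_space \<Rightarrow> 'b::real_normed_vector"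
  assumes "lipschitz_on_compacts \<phi>" "lipschitz_on_compacts \<psi>"
  shows "lipschitz_on_compacts (\<lambda>x. \<phi> x + \<psi> x)"
proof (rule lipschitz_on_compactsI)
  fix S :: "'a set" assume S: "compact S"
  obtain L M where "L-lipschitz_on S \<phi>" "M-lipschitz_on S \<psi>"
    using assms S lipschitz_on_compactsE by metis
  then show "\<exists>K. K-lipschitz_on S (\<lambda>x. \<phi> x + \<psi> x)"
    using lipschitz_on_add by blast
qed

lemma lipschitz_on_compacts_mult:
  fixes \<phi> \<psi> :: "'a::metric_space \<Rightarrow> real"
  assumes "lipschitz_on_compacts \<phi>" "lipschitz_on_compacts \<psi>"
  shows "lipschitz_on_compacts (\<lambda>x. \<phi> x * \<psi> x)"
proof (rule lipschitz_on_compactsI)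
  fix S :: "'a set" assume S: "compact S"
  obtain L M where L: "L-lipschitz_on S \<phi>" and M: "M-lipschitz_on S \<psi>"
    using assms S lipschitz_on_compactsE by metis
  obtain A where A: "A > 0" "\<And>x. x \<in> S \<Longrightarrow> \<bar>\<phi> x\<bar> \<le> A"
    using compact_imp_bounded[OF compact_continuous_image[OF lipschitz_on_continuous_on[OF L] S]]
    unfolding bounded_pos by auto
  obtain B where B: "B > 0" "\<And>x. x \<in> S \<Longrightarrow> \<bar>\<psi> x\<bar> \<le> B"
    using compact_imp_bounded[OF compact_continuous_image[OF lipschitz_on_continuous_on[OF M] S]]
    unfolding bounded_pos by auto
  have "(A * M + B * L)-lipschitz_on S (\<lambda>x. \<phi> x * \<psi> x)"
  proof (rule lipschitz_onI)
    show "0 \<le> A * M + B * L"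
      using A(1) B(1) lipschitz_on_nonneg[OF L] lipschitz_on_nonneg[OF M] by simp
    fix x y assume xy: "x \<in> S" "y \<in> S"
    have "\<bar>\<phi> x * \<psi> x - \<phi> y * \<psi> y\<bar> = \<bar>\<phi> x * (\<psi> x - \<psi> y) + \<psi> y * (\<phi> x - \<phi> y)\<bar>"
      by (simp add: algebra_simps)
    also have "\<dots> \<le> \<bar>\<phi> x\<bar> * \<bar>\<psi> x - \<psi> y\<bar> + \<bar>\<psi> y\<bar> * \<bar>\<phi> x - \<phi> y\<bar>"
      by (metis abs_mult abs_triangle_ineq)
    also have "\<dots> \<le> A * (M * dist x y) + B * (L * dist x y)"
      using A B xy lipschitz_onD[OF L xy] lipschitz_onD[OF M xy]
      by (intro add_mono mult_mono) (auto simp: dist_real_def)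
    finally show "dist (\<phi> x * \<psi> x) (\<phi> y * \<psi> y) \<le> (A * M + B * L) * dist x y"
      by (simp add: dist_real_def algebra_simps)
  qed
  then show "\<exists>K. K-lipschitz_on S (\<lambda>x. \<phi> x * \<psi> x)" by blast
qed

lemma lipschitz_on_compacts_sum:
  fixes \<phi> :: "'k \<Rightarrow> 'a::metric_space \<Rightarrow> 'b::real_normed_vector"
  shows "(\<And>k. k \<in> A \<Longrightarrow> lipschitz_on_compacts (\<phi> k)) \<Longrightarrow> lipschitz_on_compacts (\<lambda>x. \<Sum>k\<in>A. \<phi> k x)"
  by (induction A rule: infinite_finite_induct)
     (auto intro: lipschitz_on_compacts_const lipschitz_on_compacts_add)

lemma lipschitz_on_compacts_prod:
  fixes \<phi> :: "'k \<Rightarrow> 'a::metric_space \<Rightarrow> real"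
  shows "(\<And>k. k \<in> A \<Longrightarrow> lipschitz_on_compacts (\<phi> k)) \<Longrightarrow> lipschitz_on_compacts (\<lambda>x. \<Prod>k\<in>A. \<phi> k x)"
  by (induction A rule: infinite_finite_induct)
     (auto intro: lipschitz_on_compacts_const lipschitz_on_compacts_mult)

lemma lipschitz_on_compacts_power:
  fixes \<phi> :: "'a::metric_space \<Rightarrow> real"
  shows "lipschitz_on_compacts \<phi> \<Longrightarrow> lipschitz_on_compacts (\<lambda>x. \<phi> x ^ n)"
  by (induction n) (auto intro: lipschitz_on_compacts_const lipschitz_on_compacts_mult)

lemma lipschitz_on_compacts_vec:
  fixes \<phi> :: "'a::metric_space \<Rightarrow> real ^ 'n"
  assumes "\<And>i. lipschitz_on_compacts (\<lambda>x. \<phi> x $ i)"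
  shows "lipschitz_on_compacts \<phi>"
proof (rule lipschitz_on_compactsI)
  fix S :: "'a set" assume S: "compact S"
  have "\<forall>i. \<exists>L. L-lipschitz_on S (\<lambda>x. \<phi> x $ i)"
    using lipschitz_on_compactsE[OF assms S] by metis
  then obtain L where L: "\<And>i. (L i)-lipschitz_on S (\<lambda>x. \<phi> x $ i)"
    using choice by metis
  have "(\<Sum>i\<in>UNIV. L i)-lipschitz_on S \<phi>"
  proof (rule lipschitz_onI)
    show "0 \<le> (\<Sum>i\<in>UNIV. L i)" by (intro sum_nonneg lipschitz_on_nonneg[OF L])
    fix x y assume xy: "x \<in> S" "y \<in> S"
    have "dist (\<phi> x) (\<phi> y) \<le> (\<Sum>i\<in>UNIV. \<bar>(\<phi> x - \<phi> y) $ i\<bar>)"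
      unfolding dist_norm by (rule norm_le_l1_cart)
    also have "\<dots> \<le> (\<Sum>i\<in>UNIV. L i * dist x y)"
      using lipschitz_onD[OF L xy] by (intro sum_mono) (simp add: dist_real_def)
    finally show "dist (\<phi> x) (\<phi> y) \<le> (\<Sum>i\<in>UNIV. L i) * dist x y"
      by (simp add: sum_distrib_right)
  qed
  then show "\<exists>L. L-lipschitz_on S \<phi>" by blast
qed

lemma lipschitz_on_compacts_imp_continuous_on:
  fixes \<phi> :: "'a::heine_borel \<Rightarrow> 'b::metric_space"
  assumes "lipschitz_on_compacts \<phi>"
  shows "continuous_on UNIV \<phi>"
proof -
  have "isCont \<phi> x" for x
  proof -
    obtain L where "L-lipschitz_on (cball x 1) \<phi>"
      using assms compact_cball lipschitz_on_compactsE by metis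
    then have "continuous_on (cball x 1) \<phi>" by (rule lipschitz_on_continuous_on)
    then have "continuous_on (ball x 1) \<phi>" by (rule continuous_on_subset) auto
    then show ?thesis using continuous_on_eq_continuous_at[OF open_ball] by (metis centre_in_ball zero_less_one)
  qed
  then show ?thesis by (simp add: continuous_at_imp_continuous_on)
qed

lemma lipschitz_on_compacts_poly_eval:
  assumes "\<And>i. lipschitz_on_compacts (\<lambda>q. y q i)"
  shows "lipschitz_on_compacts (\<lambda>q. poly_eval p (y q))"
  unfolding poly_eval_def
  by (intro lipschitz_on_compacts_sum lipschitz_on_compacts_mult lipschitz_on_compacts_const
      lipschitz_on_compacts_prod lipschitz_on_compacts_power assms)

lemma lipschitz_on_compacts_join:
  fixes i :: "'n::finite + 'm::finite"
  shows "lipschitz_on_compacts (\<lambda>q. join (fst q) (snd q) i)"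
proof -
  have "1-lipschitz_on S (\<lambda>q::(real ^ 'n) \<times> (real ^ 'm). join (fst q) (snd q) i)" for S
  proof (rule lipschitz_onI)
    fix q r :: "(real ^ 'n) \<times> (real ^ 'm)"
    have "dist (fst q $ a) (fst r $ a) \<le> dist q r" "dist (snd q $ b) (snd r $ b) \<le> dist q r" for a b
      using dist_vec_nth_le[of "fst q" a "fst r"] dist_vec_nth_le[of "snd q" b "snd r"]
        dist_fst_le[of q r] dist_snd_le[of q r] by linarith+
    then show "dist (join (fst q) (snd q) i) (join (fst r) (snd r) i) \<le> 1 * dist q r"
      by (cases i) (simp_all add: join_def)
  qed simp
  then show ?thesis by (intro lipschitz_on_compactsI exI)
qed

section \<open>Invariance of the polytope\<close>

theorem proposition4p3:
  fixes f :: "(('n::finite + 'm::finite) rpoly) ^ 'n"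
    and g :: "(('n + 'm) rpoly) ^ 'p::finite ^ 'n"
    and H :: "('n rpoly) ^ 'q::finite ^ 'p"
    and G :: "(('n + 'm) rpoly) ^ 'q ^ 'n"
    and \<delta> :: "'n \<Rightarrow> nat" and \<rho> :: "'m \<Rightarrow> nat"
    and xlo xhi :: "real ^ 'n" and dlo dhi :: "real ^ 'm"
    and KX :: "'kx set" and KD :: "'kd set" and KU :: "'ku set"
    and \<gamma> :: "'kx \<Rightarrow> real ^ 'n" and \<eta> :: "'kx \<Rightarrow> real"
    and \<alpha>D :: "'kd \<Rightarrow> real ^ 'm" and \<beta>D :: "'kd \<Rightarrow> real"
    and \<alpha>U :: "'ku \<Rightarrow> real ^ 'p" and \<beta>U :: "'ku \<Rightarrow> real"
    and RX P :: "(real ^ 'n) set" and D RD :: "(real ^ 'm) set" and U :: "(real ^ 'p) set"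
    and Feas :: "(real \<times> (real ^ 'q) \<times> ('kx \<Rightarrow> 'kx \<Rightarrow> real) \<times> ('kx \<Rightarrow> 'kd \<Rightarrow> real)) set"
    and dstar tstar :: real and \<theta>star :: "real ^ 'q"
    and Lstar :: "'kx \<Rightarrow> 'kx \<Rightarrow> real" and Mstar :: "'kx \<Rightarrow> 'kd \<Rightarrow> real"
  assumes G: "\<And>x d. eval_mat G (join x d) = eval_mat g (join x d) ** eval_mat H (($) x)"
    and \<delta>_pos: "\<And>i. 1 \<le> \<delta> i" and \<rho>_pos: "\<And>j. 1 \<le> \<rho> j"
    and deg_f: "\<And>i. degrees_le (case_sum \<delta> \<rho>) (f $ i)"
    and deg_G: "\<And>i j. degrees_le (case_sum \<delta> \<rho>) (G $ i $ j)"
    and deg_H: "\<And>i j. degrees_le \<delta> (H $ i $ j)"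
    and RX: "RX = cbox xlo xhi" "\<And>k. xlo $ k < xhi $ k"
    and fin: "finite KX" "finite KD" "finite KU"
    and D: "D = {d. \<forall>k\<in>KD. \<alpha>D k \<bullet> d \<le> \<beta>D k}" "D \<noteq> {}" "compact D"
    and U: "U = {u. \<forall>k\<in>KU. \<alpha>U k \<bullet> u \<le> \<beta>U k}" "U \<noteq> {}" "compact U"
    and RD: "RD = cbox dlo dhi" "D \<subseteq> RD" "\<And>a b. D \<subseteq> cbox a b \<Longrightarrow> RD \<subseteq> cbox a b"
    and P: "P = {x. \<forall>k\<in>KX. \<gamma> k \<bullet> x \<le> \<eta> k}" "P \<subseteq> RX"
    and Feas: "Feas = {(t, \<theta>, L, M).
          (\<forall>k\<in>KX. \<forall>i\<in>KX - {k}. L k i \<ge> 0) \<and>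
          (\<forall>k\<in>KX. \<forall>j\<in>KD. M k j \<ge> 0) \<and>
          (\<forall>l\<in>KU. \<forall>vX\<in>vertex_classes \<delta> xlo xhi.
             \<alpha>U l \<bullet> (blossom_mat \<delta> H (rep vX) *v \<theta>) \<le> \<beta>U l) \<and>
          (\<forall>k\<in>KX. \<forall>vX\<in>vertex_classes \<delta> xlo xhi. \<forall>vD\<in>vertex_classes \<rho> dlo dhi.
             t \<le> - (\<gamma> k \<bullet> (blossom_vec (case_sum \<delta> \<rho>) f (case_sum (rep vX) (rep vD))
                           + blossom_mat (case_sum \<delta> \<rho>) G (case_sum (rep vX) (rep vD)) *v \<theta>))
                 + (\<Sum>i\<in>KX. L k i * (lifted_inner \<delta> (lift_vec \<delta> (\<gamma> i)) (rep vX) - \<eta> i))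
                 + (\<Sum>j\<in>KD. M k j * (lifted_inner \<rho> (lift_vec \<rho> (\<alpha>D j)) (rep vD) - \<beta>D j)))}"
    and opt_value: "dstar = Sup (fst ` Feas)"
    and opt_solution: "(tstar, \<theta>star, Lstar, Mstar) \<in> Feas" "\<And>y. y \<in> Feas \<Longrightarrow> fst y \<le> tstar"
    and positive: "dstar > 0"
  shows "(\<forall>x\<in>RX. eval_mat H (($) x) *v \<theta>star \<in> U) \<and>
    invariant_under
      (\<lambda>x d. eval_vec f (join x d) + eval_mat g (join x d) *v (eval_mat H (($) x) *v \<theta>star)) D P"
proof -
  define F where "F = (\<lambda>x d. eval_vec f (join x d) + eval_mat g (join x d) *v (eval_mat H (($) x) *v \<theta>star))"
  \<comment> \<open>With \<open>g\<close> and \<open>H\<close> merged into \<open>G\<close>, the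
    closed-loop field is affine in \<open>\<theta>star\<close>, with exactly the coefficients whose
    blossoms enter the program.\<close>
  have F: "F x d = eval_vec f (join x d) + eval_mat G (join x d) *v \<theta>star" for x d
    by (simp add: F_def G matrix_vector_mul_assoc)
  \<comment> \<open>The supremum is attained at the optimal solution, so positivity passes from
    \<open>dstar\<close> to \<open>tstar\<close>.\<close>
  have "Sup (fst ` Feas) = tstar"
    using opt_solution by (intro cSup_eq_maximum) force+
  then have tpos: "tstar > 0" using positive opt_value by simp
  have feas: "\<And>k i. k \<in> KX \<Longrightarrow> i \<in> KX - {k} \<Longrightarrow> Lstar k i \<ge> 0"
    "\<And>k j. k \<in> KX \<Longrightarrow> j \<in> KD \<Longrightarrow> Mstar k j \<ge> 0"
    "\<And>l vX. l \<in> KU \<Longrightarrow> vX \<in> vertex_classes \<delta> xlo xhi \<Longrightarrow>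
       \<alpha>U l \<bullet> (blossom_mat \<delta> H (rep vX) *v \<theta>star) \<le> \<beta>U l"
    "\<And>k vX vD. k \<in> KX \<Longrightarrow> vX \<in> vertex_classes \<delta> xlo xhi \<Longrightarrow> vD \<in> vertex_classes \<rho> dlo dhi \<Longrightarrow>
       tstar \<le> - (\<gamma> k \<bullet> (blossom_vec (case_sum \<delta> \<rho>) f (case_sum (rep vX) (rep vD))
                     + blossom_mat (case_sum \<delta> \<rho>) G (case_sum (rep vX) (rep vD)) *v \<theta>star))
             + (\<Sum>i\<in>KX. Lstar k i * (lifted_inner \<delta> (lift_vec \<delta> (\<gamma> i)) (rep vX) - \<eta> i))
             + (\<Sum>j\<in>KD. Mstar k j * (lifted_inner \<rho> (lift_vec \<rho> (\<alpha>D j)) (rep vD) - \<beta>D j))"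
    using opt_solution(1) unfolding Feas mem_Collect_eq prod.case by blast+

  \<comment> \<open>Input constraints on the state box\<close>
  have "\<alpha>U l \<bullet> (eval_mat H (($) x) *v \<theta>star) \<le> \<beta>U l" if l: "l \<in> KU" and x: "x \<in> RX" for l x
  proof -
    \<comment> \<open>The sign is reversed because the diagonal lemma transports lower
      bounds.\<close>
    define \<Phi> where "\<Phi> z = - (\<alpha>U l \<bullet> (blossom_mat \<delta> H z *v \<theta>star))" for z
    have "- \<beta>U l \<le> \<Phi> (\<lambda>i s. x $ i)"
    proof (rule multi_affine_ge_diagonal)
      show "multi_affine \<Phi>"
        unfolding \<Phi>_def inner_matrix_vector blossom_mat_def
        by (simp, intro multi_affine_intros multi_affine_blossom)
      show "\<Phi> z' = \<Phi> z" if "block_perm \<delta> z z'" for z z'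
        using blossom_block_perm[OF that] by (simp add: \<Phi>_def blossom_mat_def)
      show "- \<beta>U l \<le> \<Phi> (rep c)" if "c \<in> vertex_classes \<delta> xlo xhi" for c
        using feas(3)[OF l that] by (simp add: \<Phi>_def)
      show "x \<in> cbox xlo xhi" using x RX(1) by simp
    qed
    moreover have "blossom_mat \<delta> H (\<lambda>i s. x $ i) = eval_mat H (($) x)"
      by (simp add: blossom_mat_def eval_mat_def blossom_diagonal[OF deg_H])
    ultimately show ?thesis by (simp add: \<Phi>_def)
  qed
  then have input: "\<forall>x\<in>RX. eval_mat H (($) x) *v \<theta>star \<in> U"
    by (simp add: U(1))

  \<comment> \<open>Descent of the lifted inequality to states and disturbances\<close>
  have bound: "\<gamma> k \<bullet> F x d \<le> - tstar + (\<Sum>i\<in>KX. Lstar k i * (\<gamma> i \<bullet> x - \<eta> i))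
      + (\<Sum>j\<in>KD. Mstar k j * (\<alpha>D j \<bullet> d - \<beta>D j))"
    if k: "k \<in> KX" and x: "x \<in> RX" and d: "d \<in> RD" for k x d
  proof -
    let ?b = "case_sum \<delta> \<rho>"
    \<comment> \<open>The right-hand side of the program's last constraint as a function of the
      joint lifted variable; \<open>Inl\<close> and \<open>Inr\<close> select the state and
      disturbance blocks.\<close>
    define \<Phi> where "\<Phi> z = - (\<gamma> k \<bullet> (blossom_vec ?b f z + blossom_mat ?b G z *v \<theta>star))
             + (\<Sum>i\<in>KX. Lstar k i * (lifted_inner \<delta> (lift_vec \<delta> (\<gamma> i)) (z \<circ> Inl) - \<eta> i))
             + (\<Sum>j\<in>KD. Mstar k j * (lifted_inner \<rho> (lift_vec \<rho> (\<alpha>D j)) (z \<circ> Inr) - \<beta>D j))" for z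
    have "tstar \<le> \<Phi> (\<lambda>i s. join x d i)"
    proof (rule multi_affine_ge_diagonal_sum)
      show "multi_affine \<Phi>"
        unfolding \<Phi>_def inner_add_matrix_vector blossom_mat_def blossom_vec_def
        by (simp, intro multi_affine_intros multi_affine_blossom
            multi_affine_comp_Inl[OF multi_affine_lifted_inner]
            multi_affine_comp_Inr[OF multi_affine_lifted_inner])
      show "\<Phi> z' = \<Phi> z" if z: "block_perm ?b z z'" for z z'
      proof -
        have "block_perm \<delta> (z \<circ> Inl) (z' \<circ> Inl)" "block_perm \<rho> (z \<circ> Inr) (z' \<circ> Inr)"
          using z unfolding block_perm_def by (metis comp_apply sum.case(1), metis comp_apply sum.case(2))
        then show ?thesis
          by (simp add: \<Phi>_def blossom_mat_def blossom_vec_def blossom_block_perm[OF z]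
              lifted_inner_block_perm)
      qed
      show "tstar \<le> \<Phi> (case_sum (rep c) (rep e))"
        if "c \<in> vertex_classes \<delta> xlo xhi" "e \<in> vertex_classes \<rho> dlo dhi" for c e
      proof -
        have "case_sum (rep c) (rep e) \<circ> Inl = rep c" "case_sum (rep c) (rep e) \<circ> Inr = rep e"
          by auto
        then show ?thesis using feas(4)[OF k that] by (simp only: \<Phi>_def)
      qed
      show "x \<in> cbox xlo xhi" "d \<in> cbox dlo dhi" using x d RX(1) RD(1) by simp_all
    qed
    moreover have "blossom_vec ?b f (\<lambda>i s. join x d i) = eval_vec f (join x d)"
      by (simp add: blossom_vec_def eval_vec_def blossom_diagonal[OF deg_f])
    moreover have "blossom_mat ?b G (\<lambda>i s. join x d i) = eval_mat G (join x d)"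
      by (simp add: blossom_mat_def eval_mat_def blossom_diagonal[OF deg_G])
    moreover have "(\<lambda>i (s::nat). join x d i) \<circ> Inl = (\<lambda>i s. x $ i)"
      "(\<lambda>i (s::nat). join x d i) \<circ> Inr = (\<lambda>i s. d $ i)"
      by (auto simp: join_def)
    ultimately have "tstar \<le> - (\<gamma> k \<bullet> F x d) + (\<Sum>i\<in>KX. Lstar k i * (\<gamma> i \<bullet> x - \<eta> i))
        + (\<Sum>j\<in>KD. Mstar k j * (\<alpha>D j \<bullet> d - \<beta>D j))"
      by (simp only: \<Phi>_def F lifted_inner_diagonal[of \<delta>, OF \<delta>_pos] lifted_inner_diagonal[of \<rho>, OF \<rho>_pos])
    then show ?thesis by linarith
  qed

  \<comment> \<open>Strictly inward field on the facets\<close>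
  have inward: "\<gamma> k \<bullet> F x d < 0"
    if x: "x \<in> P" and d: "d \<in> D" and k: "k \<in> KX" and face: "\<gamma> k \<bullet> x = \<eta> k" for x d k
  proof -
    have "(\<Sum>i\<in>KX. Lstar k i * (\<gamma> i \<bullet> x - \<eta> i)) \<le> 0"
    proof (rule sum_nonpos)
      fix i assume i: "i \<in> KX"
      show "Lstar k i * (\<gamma> i \<bullet> x - \<eta> i) \<le> 0"
      \<comment> \<open>\<open>Lstar k k\<close> may have either sign, but its factor vanishes on
        the facet \<open>k\<close>.\<close>
      proof (cases "i = k")
        case False
        then show ?thesis using feas(1)[OF k, of i] x i by (auto simp: P(1) intro!: mult_nonneg_nonpos)
      qed (simp add: face)
    qed
    moreover have "(\<Sum>j\<in>KD. Mstar k j * (\<alpha>D j \<bullet> d - \<beta>D j)) \<le> 0"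
      using feas(2)[OF k] d by (intro sum_nonpos mult_nonneg_nonpos) (auto simp: D(1))
    ultimately show ?thesis
      using bound[OF k, of x d] x d P(2) RD(2) tpos by fastforce
  qed

  \<comment> \<open>Regularity of the closed-loop field\<close>
  have lipF: "lipschitz_on_compacts (\<lambda>q. F (fst q) (snd q))"
  proof (rule lipschitz_on_compacts_vec)
    fix i
    have "F (fst q) (snd q) $ i = poly_eval (f $ i) (join (fst q) (snd q))
        + (\<Sum>j\<in>UNIV. poly_eval (G $ i $ j) (join (fst q) (snd q)) * \<theta>star $ j)" for q
      by (simp add: F eval_vec_def eval_mat_def matrix_vector_mult_def)
    then show "lipschitz_on_compacts (\<lambda>q. F (fst q) (snd q) $ i)"
      by (simp only:) (intro lipschitz_on_compacts_add lipschitz_on_compacts_sum lipschitz_on_compacts_mult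
          lipschitz_on_compacts_const lipschitz_on_compacts_poly_eval lipschitz_on_compacts_join)
  qed
  have contF: "continuous_on UNIV (\<lambda>(x, d). F x d)"
    using lipschitz_on_compacts_imp_continuous_on[OF lipF] by (simp add: case_prod_beta)
  have lip: "\<exists>L. \<forall>d\<in>D. L-lipschitz_on (cball 0 r) (\<lambda>x. F x d)" for r
  proof -
    obtain L where L: "L-lipschitz_on (cball 0 r \<times> D) (\<lambda>q. F (fst q) (snd q))"
      using lipschitz_on_compactsE[OF lipF compact_Times[OF compact_cball D(3)]] by metis
    \<comment> \<open>\<open>(x, d)\<close> and \<open>(y, d)\<close> are as far apart as
      \<open>x\<close> and \<open>y\<close>, so one \<open>L\<close> serves all
      \<open>d\<close>.\<close>
    have "L-lipschitz_on (cball 0 r) (\<lambda>x. F x d)" if d: "d \<in> D" for d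
    proof (rule lipschitz_onI)
      fix x y :: "real ^ 'n" assume "x \<in> cball 0 r" "y \<in> cball 0 r"
      then show "dist (F x d) (F y d) \<le> L * dist x y"
        using lipschitz_onD[OF L, of "(x, d)" "(y, d)"] d by (simp add: dist_Pair_Pair)
    qed (rule lipschitz_on_nonneg[OF L])
    then show ?thesis by blast
  qed
  have "compact P"
  proof -
    have "P = (\<Inter>k\<in>KX. {x. \<gamma> k \<bullet> x \<le> \<eta> k})" by (auto simp: P(1))
    then have "closed P" by (simp add: closed_INT closed_halfspace_le)
    moreover have "bounded P" using bounded_subset[OF bounded_cbox] P(2) RX(1) by blast
    ultimately show ?thesis by (simp add: compact_eq_bounded_closed)
  qed

  \<comment> \<open>Invariance and global existence\<close>
  have "invariant_under F D P"
    unfolding invariant_under_def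
  proof (intro allI impI, elim conjE)
    fix d I x
    assume d: "disturbance_signal D d" and max: "maximal_solution_on F d I x" and x0: "x 0 \<in> P"
    have sol: "solution_on F d I x" using max by (simp add: maximal_solution_on_def)
    \<comment> \<open>Staying in \<open>P\<close> is settled on the domain \<open>I\<close> first;
      only then can compactness of \<open>P\<close> force \<open>I\<close> to be all of
      \<open>{0..}\<close>.\<close>
    have inP: "x t \<in> P" if "t \<in> I" for t
      by (rule polyhedron_invariant_if_strictly_inward[OF contF D(3) d sol fin(1) P(1) x0 inward that])
    moreover have "I = {0..}"
      by (rule maximal_solution_in_compact_global[OF contF D(3) lip d max \<open>compact P\<close> inP])
    ultimately show "I = {0..} \<and> (\<forall>t\<ge>0. x t \<in> P)" by simp
  qed
  then show ?thesis using input by (simp only: F_def simp_thms)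
qed

end
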